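(* Let $G$ be a framework for a $3$-connected matroid $M$. If $G$ has a loop-edge, then $M$ is either a frame matroid or a lifted-graphic matroid.
   Context: For a graph $G$ and a vertex $v$, $\mathrm{loops}_G(v)$ denotes the set of loop-edges of $G$ at $v$. Graphs are finite and may have loops and parallel edges. For a set $X$ of edges, $G[X]$ is the subgraph of $G$ with edge-set $X$ and no isolated vertices. A graph $G$ is a framework for a matroid $M$ if (1) $E(G)=E(M)$; (2) $r_M(E(H))\le |V(H)|$ for each component $H$ of $G$; (3) for each vertex $v$ of $G$, $\mathrm{cl}_M(E(G-v))\subseteq E(G-v)\cup \mathrm{loops}_G(v)$; and (4) for each circuit $C$ of $M$, the subgraph $G[C]$ has at most two components. A framed matroid is a pair $(M,V)$ where $M$ is a matroid, $V$ is a basis of $M$, and each element of $M$ is spanned by a subset of $V$ with at most two elements; $M$ is a frame matroid if there is a framed matroid $(M',V)$ with $M=M'\setminus V$. A matroid $M$ is lifted-graphic if there is a matroid $M'$ and $e\in E(M')$ with $M'\setminus e=M$ and $M'/e$ graphic. *)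

theory Defs
  imports Main
begin

section \<open>Matroids\<close>

record 'e pre_matroid =
  ground :: "'e set"
  indeps :: "'e set set"

locale matroid =
  fixes M :: "'e pre_matroid"
  assumes finite_ground: "finite (ground M)"
    and indeps_subset_ground: "X \<in> indeps M \<Longrightarrow> X \<subseteq> ground M"
    and empty_indep: "{} \<in> indeps M"
    and indep_subset: "X \<in> indeps M \<Longrightarrow> Y \<subseteq> X \<Longrightarrow> Y \<in> indeps M"
    and augment: "X \<in> indeps M \<Longrightarrow> Y \<in> indeps M \<Longrightarrow> card X < card Y \<Longrightarrow>
      \<exists>y \<in> Y - X. insert y X \<in> indeps M"

definition basis_of :: "'e pre_matroid \<Rightarrow> 'e set \<Rightarrow> 'e set \<Rightarrow> bool" where
  "basis_of M X B \<longleftrightarrow> B \<in> indeps M \<and> B \<subseteq> X \<and>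
     (\<forall>B' \<in> indeps M. B \<subseteq> B' \<and> B' \<subseteq> X \<longrightarrow> B' = B)"

abbreviation basis :: "'e pre_matroid \<Rightarrow> 'e set \<Rightarrow> bool" where
  "basis M B \<equiv> basis_of M (ground M) B"

definition circuit :: "'e pre_matroid \<Rightarrow> 'e set \<Rightarrow> bool" where
  "circuit M C \<longleftrightarrow> C \<subseteq> ground M \<and> C \<notin> indeps M \<and> (\<forall>D. D \<subset> C \<longrightarrow> D \<in> indeps M)"

definition rank :: "'e pre_matroid \<Rightarrow> 'e set \<Rightarrow> nat" where
  "rank M X = Max (card ` {I \<in> indeps M. I \<subseteq> X})"

definition cl :: "'e pre_matroid \<Rightarrow> 'e set \<Rightarrow> 'e set" where
  "cl M X = {e \<in> ground M. rank M (insert e X) = rank M X}"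

definition delete :: "'e pre_matroid \<Rightarrow> 'e set \<Rightarrow> 'e pre_matroid" where
  "delete M D = \<lparr>ground = ground M - D, indeps = {X \<in> indeps M. X \<inter> D = {}}\<rparr>"

definition contract :: "'e pre_matroid \<Rightarrow> 'e set \<Rightarrow> 'e pre_matroid" where
  "contract M T = \<lparr>ground = ground M - T,
     indeps = {X. X \<subseteq> ground M - T \<and> (\<exists>B. basis_of M T B \<and> X \<union> B \<in> indeps M)}\<rparr>"

definition relabel :: "('e \<Rightarrow> 'f) \<Rightarrow> 'e pre_matroid \<Rightarrow> 'f pre_matroid" where
  "relabel f M = \<lparr>ground = f ` ground M, indeps = (\<lambda>X. f ` X) ` indeps M\<rparr>"

text \<open>Tutte connectivity; the last conjunct is \<open>r(X) + r(Y) - r(M) < k\<close> without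
  subtraction on \<open>nat\<close>.\<close>

definition k_separation :: "nat \<Rightarrow> 'e pre_matroid \<Rightarrow> 'e set \<Rightarrow> 'e set \<Rightarrow> bool" where
  "k_separation k M X Y \<longleftrightarrow> X \<union> Y = ground M \<and> X \<inter> Y = {} \<and> k \<le> card X \<and> k \<le> card Y \<and>
     rank M X + rank M Y < rank M (ground M) + k"

definition n_connected :: "nat \<Rightarrow> 'e pre_matroid \<Rightarrow> bool" where
  "n_connected n M \<longleftrightarrow> (\<forall>k X Y. 1 \<le> k \<and> k < n \<longrightarrow> \<not> k_separation k M X Y)"


section \<open>Graphs with loops and parallel edges\<close>

text \<open>An edge \<open>e\<close> has the set \<open>ends G e\<close> of end vertices, which is a singleton if \<open>e\<close> is a loop.
  The values of \<open>ends G\<close> outside \<open>edges G\<close> are irrelevant.\<close>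

record ('v, 'e) pre_graph =
  verts :: "'v set"
  edges :: "'e set"
  ends :: "'e \<Rightarrow> 'v set"

locale graph =
  fixes G :: "('v, 'e) pre_graph"
  assumes finite_verts: "finite (verts G)"
    and finite_edges: "finite (edges G)"
    and ends_subset_verts: "e \<in> edges G \<Longrightarrow> ends G e \<subseteq> verts G"
    and card_ends: "e \<in> edges G \<Longrightarrow> card (ends G e) = 1 \<or> card (ends G e) = 2"

definition loops :: "('v, 'e) pre_graph \<Rightarrow> 'v \<Rightarrow> 'e set" where
  "loops G v = {e \<in> edges G. ends G e = {v}}"

definition degree :: "('v, 'e) pre_graph \<Rightarrow> 'v \<Rightarrow> nat" where
  "degree G v = card {e \<in> edges G. v \<in> ends G e} + card (loops G v)"

definition delete_vertex :: "('v, 'e) pre_graph \<Rightarrow> 'v \<Rightarrow> ('v, 'e) pre_graph" where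
  "delete_vertex G v =
     \<lparr>verts = verts G - {v}, edges = {e \<in> edges G. v \<notin> ends G e}, ends = ends G\<rparr>"

definition edge_subgraph :: "('v, 'e) pre_graph \<Rightarrow> 'e set \<Rightarrow> ('v, 'e) pre_graph" where
  "edge_subgraph G X = \<lparr>verts = (\<Union>e\<in>X. ends G e), edges = X, ends = ends G\<rparr>"

definition subgraph :: "('v, 'e) pre_graph \<Rightarrow> ('v, 'e) pre_graph \<Rightarrow> bool" where
  "subgraph H G \<longleftrightarrow> graph H \<and> verts H \<subseteq> verts G \<and> edges H \<subseteq> edges G \<and> ends H = ends G"

definition connected_graph :: "('v, 'e) pre_graph \<Rightarrow> bool" where
  "connected_graph G \<longleftrightarrow> verts G \<noteq> {} \<and>
     (\<forall>u \<in> verts G. \<forall>v \<in> verts G. (u, v) \<in> {(x, y). \<exists>e \<in> edges G. ends G e = {x, y}}\<^sup>*)"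

definition component :: "('v, 'e) pre_graph \<Rightarrow> ('v, 'e) pre_graph \<Rightarrow> bool" where
  "component G H \<longleftrightarrow> subgraph H G \<and> connected_graph H \<and>
     (\<forall>H'. subgraph H' G \<and> connected_graph H' \<and> subgraph H H' \<longrightarrow> H' = H)"

text \<open>Cycles are given by their edge sets: a cycle is a connected 2-regular subgraph. A loop counts
  twice in the degree, so a single loop is a cycle, and so is a pair of parallel edges.\<close>

definition cycle :: "('v, 'e) pre_graph \<Rightarrow> 'e set \<Rightarrow> bool" where
  "cycle G C \<longleftrightarrow> C \<subseteq> edges G \<and> connected_graph (edge_subgraph G C) \<and>
     (\<forall>v \<in> verts (edge_subgraph G C). degree (edge_subgraph G C) v = 2)"

definition cycle_matroid :: "('v, 'e) pre_graph \<Rightarrow> 'e pre_matroid" where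
  "cycle_matroid G =
     \<lparr>ground = edges G, indeps = {X. X \<subseteq> edges G \<and> (\<forall>C. cycle G C \<longrightarrow> \<not> C \<subseteq> X)}\<rparr>"


section \<open>Graphic, frame and lifted-graphic matroids\<close>

text \<open>As graphs are finite, it is no restriction to take their vertices from \<open>nat\<close>.\<close>

definition graphic :: "'e pre_matroid \<Rightarrow> bool" where
  "graphic M \<longleftrightarrow> (\<exists>G :: (nat, 'e) pre_graph. graph G \<and> M = cycle_matroid G)"

definition framed_matroid :: "'e pre_matroid \<Rightarrow> 'e set \<Rightarrow> bool" where
  "framed_matroid M V \<longleftrightarrow> matroid M \<and> basis M V \<and>
     (\<forall>e \<in> ground M. \<exists>S. S \<subseteq> V \<and> card S \<le> 2 \<and> e \<in> cl M S)"

text \<open>The matroid \<open>M'\<close> below extends \<open>M\<close> by new elements, for which the type of \<open>M\<close> may have no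
  room. Therefore \<open>M\<close> is embedded into the type \<open>'e + nat\<close>, which contains infinitely
  many further elements; as matroids are finite, every extension of \<open>M\<close> has a copy there.\<close>

definition frame_matroid :: "'e pre_matroid \<Rightarrow> bool" where
  "frame_matroid M \<longleftrightarrow>
     (\<exists>(M' :: ('e + nat) pre_matroid) V. framed_matroid M' V \<and> relabel Inl M = delete M' V)"

definition lifted_graphic :: "'e pre_matroid \<Rightarrow> bool" where
  "lifted_graphic M \<longleftrightarrow>
     (\<exists>(M' :: ('e + nat) pre_matroid) e. matroid M' \<and> e \<in> ground M' \<and>
        delete M' {e} = relabel Inl M \<and> graphic (contract M' {e}))"


section \<open>Frameworks\<close>

definition framework :: "('v, 'e) pre_graph \<Rightarrow> 'e pre_matroid \<Rightarrow> bool" where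
  "framework G M \<longleftrightarrow>
     edges G = ground M \<and>
     (\<forall>H. component G H \<longrightarrow> rank M (edges H) \<le> card (verts H)) \<and>
     (\<forall>v \<in> verts G. cl M (edges (delete_vertex G v)) \<subseteq> edges (delete_vertex G v) \<union> loops G v) \<and>
     (\<forall>C. circuit M C \<longrightarrow> card {H. component (edge_subgraph G C) H} \<le> 2)"

end

theory Submission
  imports Defs
begin

text \<open>
  Let \<open>e\<close> be a loop-edge at the vertex \<open>v\<close>. For every component \<open>A\<close> of \<open>G - v\<close>, the edges incident
  with \<open>A\<close> and the remaining edges have connectivity \<open>r(X) + r(Y) - r(M) \<le> 1\<close>. So, apart from the
  degenerate case that all edges are loop-edges, 3-connectivity yields a component \<open>A\<close> with which all
  edges other than \<open>e\<close> are incident.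

  If \<open>e\<close> is spanned by the edges inside \<open>A\<close>, then a rank count shows that \<open>e\<close> is spanned by every
  independent cycle. Hence \<open>M / e\<close> is the cycle matroid of \<open>G\<close> without \<open>e\<close>, and an element parallel to \<open>e\<close> exhibits \<open>M\<close> as
  lifted-graphic.

  Otherwise every circuit is connected. Indeed, let a circuit consist of two vertex-disjoint parts and
  let \<open>C1\<close> be one that can be reached from \<open>v\<close> while avoiding the other, \<open>C2\<close>. Then \<open>C1\<close> and \<open>e\<close> are joined by a
  path, so eliminating an element of \<open>C1\<close> shows that \<open>C2\<close> spans \<open>e\<close>, a contradiction. When all circuits are connected,
  a loop-edge can be added at every vertex so that these loop-edges form a basis; this gives a framed matroid.
\<close>

section \<open>Rank in matroids\<close>

context matroid
begin

lemma finite_indeps: "finite (indeps M)"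
  using finite_subset[of "indeps M" "Pow (ground M)"] finite_ground indeps_subset_ground by auto

lemma finite_indep: "X \<in> indeps M \<Longrightarrow> finite X"
  using finite_ground indeps_subset_ground finite_subset by blast

lemma card_le_rank: "I \<in> indeps M \<Longrightarrow> I \<subseteq> X \<Longrightarrow> card I \<le> rank M X"
  unfolding rank_def using finite_indeps by (intro Max_ge) auto

lemma rank_leI:
  assumes "\<And>I. I \<in> indeps M \<Longrightarrow> I \<subseteq> X \<Longrightarrow> card I \<le> n"
  shows "rank M X \<le> n"
  unfolding rank_def using finite_indeps empty_indep assms by (subst Max_le_iff) auto

lemma rank_witness: obtains I where "I \<in> indeps M" "I \<subseteq> X" "card I = rank M X"
proof -
  have "rank M X \<in> card ` {I \<in> indeps M. I \<subseteq> X}"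
    unfolding rank_def using finite_indeps empty_indep by (intro Max_in) auto
  then show ?thesis using that by auto
qed

text \<open>A largest independent set between \<open>I\<close> and \<open>X\<close> has full rank:
  otherwise augmentation from a rank witness would enlarge it.\<close>

lemma extend_indep:
  assumes "I \<in> indeps M" "I \<subseteq> X"
  obtains J where "J \<in> indeps M" "I \<subseteq> J" "J \<subseteq> X" "card J = rank M X"
proof -
  let ?S = "{J \<in> indeps M. I \<subseteq> J \<and> J \<subseteq> X}"
  have fin: "finite (card ` ?S)" and "card ` ?S \<noteq> {}" using finite_indeps assms by auto
  then have "Max (card ` ?S) \<in> card ` ?S" by (rule Max_in)
  then obtain J where J: "J \<in> ?S" "card J = Max (card ` ?S)" by auto
  have maxJ: "card K \<le> card J" if "K \<in> ?S" for K
    unfolding J(2) using that fin by (intro Max_ge imageI)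
  obtain K where K: "K \<in> indeps M" "K \<subseteq> X" "card K = rank M X" by (rule rank_witness)
  have "\<not> card J < rank M X"
  proof
    assume "card J < rank M X"
    then obtain y where y: "y \<in> K - J" "insert y J \<in> indeps M" using augment[of J K] J K by auto
    then have "insert y J \<in> ?S" using J K by auto
    then show False using maxJ[of "insert y J"] y J(1) finite_indep[of J] by auto
  qed
  moreover have "card J \<le> rank M X" using J(1) card_le_rank[of J X] by simp
  ultimately show ?thesis using J(1) that[of J] by auto
qed

lemma rank_indep: "I \<in> indeps M \<Longrightarrow> rank M I = card I"
  by (metis card_le_rank card_mono finite_indep le_antisym order_refl rank_leI)

lemma rank_mono: "X \<subseteq> Y \<Longrightarrow> rank M X \<le> rank M Y"
  by (rule rank_leI) (auto intro: card_le_rank)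

lemma rank_le_card: "finite X \<Longrightarrow> rank M X \<le> card X"
  by (rule rank_leI) (auto intro: card_mono)

lemma indep_rankI: "finite X \<Longrightarrow> rank M X = card X \<Longrightarrow> X \<in> indeps M"
  by (metis rank_witness card_subset_eq)

text \<open>Extend a maximum independent subset of \<open>X \<inter> Y\<close> to a maximum
  independent subset \<open>J\<close> of \<open>X \<union> Y\<close>, and count the traces of
  \<open>J\<close> on \<open>X\<close>, on \<open>Y\<close> and on the intersection.\<close>

lemma rank_submodular: "rank M (X \<union> Y) + rank M (X \<inter> Y) \<le> rank M X + rank M Y"
proof -
  obtain I where I: "I \<in> indeps M" "I \<subseteq> X \<inter> Y" "card I = rank M (X \<inter> Y)" by (rule rank_witness)
  obtain J where J: "J \<in> indeps M" "I \<subseteq> J" "J \<subseteq> X \<union> Y" "card J = rank M (X \<union> Y)"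
    using extend_indep[of I "X \<union> Y"] I by auto
  have fin: "finite J" by (rule finite_indep[OF J(1)])
  have "card J + card (J \<inter> X \<inter> (J \<inter> Y)) = card (J \<inter> X) + card (J \<inter> Y)"
    using card_Un_Int[of "J \<inter> X" "J \<inter> Y"] fin J(3) by (metis Int_Un_distrib finite_Int inf.absorb1)
  moreover have "card I \<le> card (J \<inter> X \<inter> (J \<inter> Y))"
    using I J fin by (intro card_mono) auto
  moreover have "card (J \<inter> X) \<le> rank M X" "card (J \<inter> Y) \<le> rank M Y"
    using J indep_subset by (auto intro!: card_le_rank)
  ultimately show ?thesis using I J by linarith
qed

lemma rank_Un_le: "rank M (X \<union> Y) \<le> rank M X + rank M Y"
  using rank_submodular[of X Y] by linarith

lemma rank_insert_le: "rank M (insert x X) \<le> rank M X + 1"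
  using rank_Un_le[of "{x}" X] rank_le_card[of "{x}"] by simp

lemma mem_cl_iff: "x \<in> ground M \<Longrightarrow> x \<in> cl M X \<longleftrightarrow> rank M (insert x X) = rank M X"
  by (simp add: cl_def)

lemma rank_insert_notin_cl:
  "x \<in> ground M \<Longrightarrow> x \<notin> cl M X \<Longrightarrow> rank M (insert x X) = rank M X + 1"
  using rank_insert_le[of x X] rank_mono[of X "insert x X", OF subset_insertI]
  by (auto simp: mem_cl_iff)

text \<open>Submodularity for \<open>insert x X\<close> and \<open>Y\<close>: their intersection
  still has rank at least \<open>rank M X\<close>, so \<open>x\<close> adds nothing to
  \<open>Y\<close> either.\<close>

lemma cl_mono:
  assumes "X \<subseteq> Y" shows "cl M X \<subseteq> cl M Y"
proof
  fix x assume x: "x \<in> cl M X"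
  have "rank M (insert x X \<union> Y) + rank M (insert x X \<inter> Y) \<le> rank M (insert x X) + rank M Y"
    by (rule rank_submodular)
  moreover have "insert x X \<union> Y = insert x Y" using assms by auto
  moreover have "rank M X \<le> rank M (insert x X \<inter> Y)" using assms by (intro rank_mono) auto
  moreover have "rank M Y \<le> rank M (insert x Y)" by (intro rank_mono) auto
  ultimately show "x \<in> cl M Y" using x by (auto simp: cl_def)
qed

lemma subset_cl: "X \<subseteq> ground M \<Longrightarrow> X \<subseteq> cl M X"
  by (auto simp: cl_def insert_absorb)

lemma rank_Un_cl:
  assumes "finite Z" "Z \<subseteq> cl M X" shows "rank M (X \<union> Z) = rank M X"
  using assms
proof (induction Z rule: finite_induct)
  case (insert z Z)
  have "z \<in> cl M (X \<union> Z)" using insert cl_mono[of X "X \<union> Z"] by auto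
  then show ?case using insert by (simp add: cl_def)
qed simp

section \<open>Circuits and closure\<close>

lemma dependent_imp_circuit:
  assumes "X \<subseteq> ground M" "X \<notin> indeps M"
  obtains C where "circuit M C" "C \<subseteq> X"
proof -
  let ?S = "{D. D \<subseteq> X \<and> D \<notin> indeps M}"
  have "finite X" using assms finite_ground finite_subset by auto
  then have "finite ?S" "X \<in> ?S" using assms by auto
  from finite_has_minimal2[OF this]
  obtain C where C: "C \<in> ?S" "\<forall>D\<in>?S. D \<subseteq> C \<longrightarrow> C = D" by auto
  then have "circuit M C" using assms unfolding circuit_def by blast
  then show ?thesis using C that by auto
qed

lemma circuit_remove_indep: "circuit M C \<Longrightarrow> x \<in> C \<Longrightarrow> C - {x} \<in> indeps M"
  unfolding circuit_def by auto

lemma circuit_nonempty: "circuit M C \<Longrightarrow> C \<noteq> {}"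
  unfolding circuit_def using empty_indep by auto

lemma circuit_finite: "circuit M C \<Longrightarrow> finite C"
  unfolding circuit_def using finite_ground finite_subset by auto

lemma rank_circuit:
  assumes "circuit M C" shows "rank M C + 1 = card C"
proof -
  obtain x where x: "x \<in> C" using circuit_nonempty[OF assms] by auto
  have "rank M (C - {x}) = card C - 1"
    using rank_indep[OF circuit_remove_indep[OF assms x]] x circuit_finite[OF assms] by simp
  then have "card C - 1 \<le> rank M C" using rank_mono[of "C - {x}" C] by auto
  moreover have "rank M C \<noteq> card C"
    using assms indep_rankI circuit_finite[OF assms] unfolding circuit_def by blast
  moreover have "rank M C \<le> card C" "card C > 0"
    using rank_le_card circuit_finite[OF assms] x card_gt_0_iff by auto
  ultimately show ?thesis by linarith
qed

lemma circuit_in_cl: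
  assumes "circuit M C" "x \<in> C" shows "x \<in> cl M (C - {x})"
proof -
  have "rank M (C - {x}) + 1 = card C"
    using rank_indep[OF circuit_remove_indep[OF assms]] assms circuit_finite[OF assms(1)]
    by (metis Suc_eq_plus1 card.remove)
  then show ?thesis
    using rank_circuit[OF assms(1)] assms by (auto simp: cl_def insert_absorb circuit_def)
qed

lemma circuit_through:
  assumes "I \<in> indeps M" "x \<in> ground M" "insert x I \<notin> indeps M"
  obtains C where "circuit M C" "C \<subseteq> insert x I" "x \<in> C"
proof -
  obtain C where C: "circuit M C" "C \<subseteq> insert x I"
    using dependent_imp_circuit[of "insert x I"] assms indeps_subset_ground by auto
  then have "x \<in> C" using indep_subset[OF assms(1), of C] by (auto simp: circuit_def)
  then show ?thesis using C that by auto
qed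

lemma in_cl_iff_dependent:
  assumes "I \<in> indeps M" "x \<in> ground M" "x \<notin> I"
  shows "x \<in> cl M I \<longleftrightarrow> insert x I \<notin> indeps M"
proof -
  have "insert x I \<in> indeps M \<longleftrightarrow> rank M (insert x I) = card I + 1"
    using rank_indep[of "insert x I"] indep_rankI[of "insert x I"] finite_indep[OF assms(1)] assms(3)
    by auto
  then show ?thesis
    using rank_indep[OF assms(1)] assms(2) rank_insert_notin_cl[of x I] by (auto simp: mem_cl_iff)
qed

text \<open>Maximum independent subsets of the two parts have an independent union: a circuit in the
  union would lie in one part, hence in one of the two independent sets. This is how a separator is
  recognised.\<close>

lemma rank_additive:
  assumes "X \<union> Y \<subseteq> ground M"
    and "\<And>C. circuit M C \<Longrightarrow> C \<subseteq> X \<union> Y \<Longrightarrow> C \<subseteq> X \<or> C \<subseteq> Y"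
    and "X \<inter> Y = {}"
  shows "rank M (X \<union> Y) = rank M X + rank M Y"
proof -
  obtain I where I: "I \<in> indeps M" "I \<subseteq> X" "card I = rank M X" by (rule rank_witness)
  obtain J where J: "J \<in> indeps M" "J \<subseteq> Y" "card J = rank M Y" by (rule rank_witness)
  have "I \<union> J \<in> indeps M"
  proof (rule ccontr)
    assume "I \<union> J \<notin> indeps M"
    then obtain C where C: "circuit M C" "C \<subseteq> I \<union> J"
      using dependent_imp_circuit[of "I \<union> J"] I J assms(1) by (metis Un_mono subset_trans)
    then have "C \<subseteq> X \<or> C \<subseteq> Y" using assms(2) I J by blast
    then have "C \<subseteq> I \<or> C \<subseteq> J" using C I J assms(3) by blast
    then have "C \<in> indeps M" using indep_subset[OF I(1), of C] indep_subset[OF J(1), of C] by auto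
    then show False using C(1) by (simp add: circuit_def)
  qed
  then have "card (I \<union> J) \<le> rank M (X \<union> Y)" using I J by (intro card_le_rank) auto
  moreover have "card (I \<union> J) = card I + card J"
    using I J assms(3) finite_indep by (intro card_Un_disjoint) auto
  ultimately show ?thesis using I J rank_Un_le[of X Y] by linarith
qed

end

text \<open>Distinct elements with the same image are never independent together. With
  \<open>q\<close> sending one new element to \<open>e\<close>, this is the parallel extension used
  for lifted-graphic matroids.\<close>

lemma (in matroid) matroid_pullback:
  assumes "finite A" "q ` A \<subseteq> ground M"
  shows "matroid \<lparr>ground = A, indeps = {J. J \<subseteq> A \<and> inj_on q J \<and> q ` J \<in> indeps M}\<rparr>"
proof (unfold_locales, goal_cases)
  case (4 X Y)
  then have "Y \<subseteq> A" "inj_on q Y" "q ` Y \<in> indeps M"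
    using inj_on_subset[of q X Y] indep_subset[of "q ` X" "q ` Y"] by auto
  then show ?case by simp
next
  case (5 X Y)
  then have X: "X \<subseteq> A" "inj_on q X" "q ` X \<in> indeps M" and Y: "Y \<subseteq> A" "inj_on q Y" "q ` Y \<in> indeps M"
    by auto
  have "card (q ` X) < card (q ` Y)" using 5(3) by (simp add: card_image X(2) Y(2))
  from augment[OF X(3) Y(3) this]
  obtain y where y: "y \<in> Y" "q y \<notin> q ` X" "insert (q y) (q ` X) \<in> indeps M" by auto
  then have "y \<notin> X" "inj_on q (insert y X)" using X(2) by auto
  then show ?case using y X(1) Y(1) by (intro bexI[of _ y]) auto
qed (use assms empty_indep in auto)

section \<open>Connectivity and vertex degrees in graphs\<close>

definition within :: "('e \<Rightarrow> 'v set) \<Rightarrow> 'e set \<Rightarrow> 'v set \<Rightarrow> 'e set" where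
  "within en F B = {f \<in> F. en f \<subseteq> B}"

text \<open>The relation of \<open>connected_graph\<close>, with the edge set as a parameter, so
  that a vertex set is avoided by leaving out edges. A loop-edge is the case
  \<open>x = y\<close>.\<close>

definition reach :: "('e \<Rightarrow> 'v set) \<Rightarrow> 'e set \<Rightarrow> 'v \<Rightarrow> 'v set" where
  "reach en F a = {b. (a, b) \<in> {(x, y). \<exists>f \<in> F. en f = {x, y}}\<^sup>*}"

text \<open>Connectivity, in cut form, of the graph with vertex set \<open>A\<close>; edges of \<open>F\<close> that leave \<open>A\<close> are ignored.\<close>

definition linked :: "('e \<Rightarrow> 'v set) \<Rightarrow> 'e set \<Rightarrow> 'v set \<Rightarrow> bool" where
  "linked en F A \<longleftrightarrow>
     (\<forall>T. T \<subset> A \<and> T \<noteq> {} \<longrightarrow> (\<exists>f \<in> F. en f \<subseteq> A \<and> en f \<inter> T \<noteq> {} \<and> \<not> en f \<subseteq> T))"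

definition deg :: "('e \<Rightarrow> 'v set) \<Rightarrow> 'e set \<Rightarrow> 'v \<Rightarrow> nat" where
  "deg en C a = card {f \<in> C. a \<in> en f} + card {f \<in> C. en f = {a}}"

definition proper_ends :: "('e \<Rightarrow> 'v set) \<Rightarrow> 'e set \<Rightarrow> bool" where
  "proper_ends en F \<longleftrightarrow> (\<forall>f \<in> F. card (en f) = 1 \<or> card (en f) = 2)"

lemma proper_ends_subset: "proper_ends en F \<Longrightarrow> C \<subseteq> F \<Longrightarrow> proper_ends en C"
  by (auto simp: proper_ends_def)

lemma proper_endsE:
  assumes "proper_ends en F" "f \<in> F"
  obtains x y where "en f = {x, y}"
proof -
  have "card (en f) = 1 \<or> card (en f) = 2" using assms by (auto simp: proper_ends_def)
  then show ?thesis
  proof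
    assume "card (en f) = 1"
    then obtain x where "en f = {x}" by (rule card_1_singletonE)
    then show ?thesis using that[of x x] by simp
  next
    assume "card (en f) = 2"
    then show ?thesis using that by (auto simp: card_2_iff)
  qed
qed

lemma proper_ends_finite: "proper_ends en F \<Longrightarrow> f \<in> F \<Longrightarrow> finite (en f)"
  by (erule proper_endsE) auto

lemma proper_ends_nonempty: "proper_ends en F \<Longrightarrow> f \<in> F \<Longrightarrow> en f \<noteq> {}"
  by (erule proper_endsE) auto

lemma finite_cover: "proper_ends en F \<Longrightarrow> finite F \<Longrightarrow> finite (\<Union>(en ` F))"
  using proper_ends_finite[of en F] by (intro finite_UN_I) auto

lemma linkedE:
  assumes "linked en F A" "T \<subset> A" "T \<noteq> {}"
  obtains f where "f \<in> F" "en f \<subseteq> A" "en f \<inter> T \<noteq> {}" "\<not> en f \<subseteq> T"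
proof -
  have "\<exists>f \<in> F. en f \<subseteq> A \<and> en f \<inter> T \<noteq> {} \<and> \<not> en f \<subseteq> T"
    using assms unfolding linked_def by simp
  then show ?thesis using that by auto
qed

lemma linked_mono:
  assumes "linked en F A" "F \<subseteq> F'" shows "linked en F' A"
  unfolding linked_def
proof (intro allI impI, elim conjE)
  fix T assume T: "T \<subset> A" "T \<noteq> {}"
  from linkedE[OF assms(1) T] obtain f where "f \<in> F" "en f \<subseteq> A" "en f \<inter> T \<noteq> {}" "\<not> en f \<subseteq> T" .
  then show "\<exists>f \<in> F'. en f \<subseteq> A \<and> en f \<inter> T \<noteq> {} \<and> \<not> en f \<subseteq> T" using assms(2) by blast
qed

lemma linked_within: "linked en F A \<Longrightarrow> linked en (within en F A) A"
  unfolding linked_def within_def by (simp add: Bex_def)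

lemma linked_insert:
  assumes "linked en F A" "v \<notin> A" "f \<in> F" "v \<in> en f" "en f \<inter> A \<noteq> {}" "en f \<subseteq> insert v A"
  shows "linked en F (insert v A)"
  unfolding linked_def
proof (intro allI impI, elim conjE)
  fix T assume T: "T \<subset> insert v A" "T \<noteq> {}"
  show "\<exists>f\<in>F. en f \<subseteq> insert v A \<and> en f \<inter> T \<noteq> {} \<and> \<not> en f \<subseteq> T"
  \<comment> \<open>Either \<open>T\<close> is \<open>{v}\<close> or \<open>A\<close>, and
    \<open>f\<close> crosses it, or \<open>T\<close> cuts \<open>A\<close> properly, and an edge
    inside \<open>A\<close> crosses it.\<close>
  proof (cases "T \<inter> A = {} \<or> A \<subseteq> T")
    case True
    then have "T = {v} \<or> T = A" using T by auto
    then have "en f \<inter> T \<noteq> {} \<and> \<not> en f \<subseteq> T" using assms(2,4,5) by auto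
    then show ?thesis using assms(3,6) by blast
  next
    case False
    then have "T \<inter> A \<subset> A" "T \<inter> A \<noteq> {}" by auto
    from linkedE[OF assms(1) this] obtain g where
      "g \<in> F" "en g \<subseteq> A" "en g \<inter> (T \<inter> A) \<noteq> {}" "\<not> en g \<subseteq> T \<inter> A" .
    then show ?thesis by blast
  qed
qed

text \<open>The count is supermodular: an element inside both sets is inside their intersection, and
  an element inside either is inside the union, which may hold further elements.\<close>

lemma card_within_modular:
  assumes "finite X"
  shows "card (within en X A) + card (within en X B)
    \<le> card (within en X (A \<union> B)) + card (within en X (A \<inter> B))"
proof -
  have fin: "finite (within en X D)" for D using assms by (simp add: within_def)
  have "card (within en X A) + card (within en X B)
      = card (within en X A \<union> within en X B) + card (within en X A \<inter> within en X B)"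
    by (rule card_Un_Int[OF fin fin])
  also have "within en X A \<inter> within en X B = within en X (A \<inter> B)" by (auto simp: within_def)
  also have "card (within en X A \<union> within en X B) \<le> card (within en X (A \<union> B))"
    using fin by (intro card_mono) (auto simp: within_def)
  finally show ?thesis by simp
qed

section \<open>Reachability and linked sets\<close>

lemma reach_refl: "a \<in> reach en F a"
  by (simp add: reach_def)

lemma reach_closed:
  assumes "proper_ends en F" "f \<in> F" "en f \<inter> reach en F a \<noteq> {}"
  shows "en f \<subseteq> reach en F a"
proof -
  obtain x y where xy: "en f = {x, y}" using assms by (elim proper_endsE)
  let ?R = "{(x, y). \<exists>f \<in> F. en f = {x, y}}"
  have "(x, y) \<in> ?R" "(y, x) \<in> ?R" using xy assms(2) by auto
  then show ?thesis using assms(3) xy rtrancl_into_rtrancl[of a _ ?R]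
    unfolding reach_def by auto
qed

lemma reach_least:
  assumes "a \<in> T" "\<And>f. f \<in> F \<Longrightarrow> en f \<inter> T \<noteq> {} \<Longrightarrow> en f \<subseteq> T"
  shows "reach en F a \<subseteq> T"
proof
  fix b assume "b \<in> reach en F a"
  then have "(a, b) \<in> {(x, y). \<exists>f \<in> F. en f = {x, y}}\<^sup>*" by (simp add: reach_def)
  then show "b \<in> T" by (induction rule: rtrancl_induct) (use assms in auto)
qed

lemma linked_reach:
  assumes "proper_ends en F" shows "linked en F (reach en F a)"
  unfolding linked_def
proof (intro allI impI, elim conjE)
  let ?R = "reach en F a"
  \<comment> \<open>Sets containing \<open>a\<close> suffice, since a set and its complement in
    \<open>?R\<close> are crossed by the same edges inside \<open>?R\<close>.\<close>
  have cross: "\<exists>f \<in> F. en f \<subseteq> ?R \<and> en f \<inter> T \<noteq> {} \<and> \<not> en f \<subseteq> T" if T: "T \<subset> ?R" "a \<in> T" for T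
  proof -
    obtain f where "f \<in> F" "en f \<inter> T \<noteq> {}" "\<not> en f \<subseteq> T"
      using reach_least[of a T F en] T by blast
    then show ?thesis using reach_closed[OF assms, of f a] T by blast
  qed
  fix T assume T: "T \<subset> ?R" "T \<noteq> {}"
  show "\<exists>f \<in> F. en f \<subseteq> ?R \<and> en f \<inter> T \<noteq> {} \<and> \<not> en f \<subseteq> T"
  proof (cases "a \<in> T")
    case True then show ?thesis using cross T by blast
  next
    case False
    then have "?R - T \<subset> ?R" "a \<in> ?R - T" using T reach_refl[of a en F] by auto
    from cross[OF this] show ?thesis by blast
  qed
qed

lemma linked_subset_reach:
  assumes "proper_ends en F" "linked en F A" "a \<in> A"
  shows "A \<subseteq> reach en F a"
proof (rule ccontr)
  assume "\<not> A \<subseteq> reach en F a"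
  then have "A \<inter> reach en F a \<subset> A" "A \<inter> reach en F a \<noteq> {}"
    using assms(3) reach_refl[of a en F] by auto
  from linkedE[OF assms(2) this] obtain f where "f \<in> F" "en f \<subseteq> A"
    "en f \<inter> (A \<inter> reach en F a) \<noteq> {}" "\<not> en f \<subseteq> A \<inter> reach en F a" .
  then show False using reach_closed[OF assms(1), of f a] by blast
qed

lemma linked_subset_closed:
  assumes "linked en F A" "A \<inter> T \<noteq> {}" "\<And>f. f \<in> F \<Longrightarrow> en f \<inter> T \<noteq> {} \<Longrightarrow> en f \<subseteq> T"
  shows "A \<subseteq> T"
proof (rule ccontr)
  assume "\<not> A \<subseteq> T"
  then have "A \<inter> T \<subset> A" by auto
  from linkedE[OF assms(1) this assms(2)]
  obtain f where "f \<in> F" "en f \<subseteq> A" "en f \<inter> (A \<inter> T) \<noteq> {}" "\<not> en f \<subseteq> A \<inter> T" .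
  then show False using assms(3)[of f] by blast
qed

lemma connected_graph_reach:
  "connected_graph G \<longleftrightarrow>
     verts G \<noteq> {} \<and> (\<forall>u \<in> verts G. verts G \<subseteq> reach (ends G) (edges G) u)"
  unfolding connected_graph_def reach_def by (simp add: subset_eq)

section \<open>Degree sums\<close>

lemma sum_deg:
  assumes "finite A" "finite C"
  shows "(\<Sum>a\<in>A. deg en C a) = (\<Sum>f\<in>C. card (en f \<inter> A) + card {a \<in> A. en f = {a}})"
proof -
  have "(\<Sum>a\<in>A. card {f \<in> C. a \<in> en f}) = (\<Sum>f\<in>C. card (en f \<inter> A))"
    using assms by (intro sum_multicount_gen) (auto simp: Int_def conj_commute)
  moreover have "(\<Sum>a\<in>A. card {f \<in> C. en f = {a}}) = (\<Sum>f\<in>C. card {a \<in> A. en f = {a}})"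
    using assms by (intro sum_multicount_gen) auto
  ultimately show ?thesis by (simp add: deg_def sum.distrib)
qed

lemma end_count_inside:
  assumes "card (en f) = 1 \<or> card (en f) = 2" "en f \<subseteq> A"
  shows "card (en f \<inter> A) + card {a \<in> A. en f = {a}} = 2"
  using assms(1)
proof
  assume "card (en f) = 1"
  then obtain x where x: "en f = {x}" by (rule card_1_singletonE)
  then have "{a \<in> A. en f = {a}} = {x}" "en f \<inter> A = {x}" using assms by auto
  then show ?thesis by simp
next
  assume "card (en f) = 2"
  then have no_loop: "{a \<in> A. en f = {a}} = {}" and "card (en f \<inter> A) = 2"
    using assms by (auto simp: Int_absorb2)
  then show ?thesis unfolding no_loop by simp
qed

lemma end_count_crossing:
  assumes "card (en f) = 1 \<or> card (en f) = 2" "\<not> en f \<subseteq> A"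
  shows "card (en f \<inter> A) + card {a \<in> A. en f = {a}} \<le> 1"
proof -
  have "finite (en f)" using assms(1) card.infinite by fastforce
  then have "card (en f \<inter> A) < card (en f)" using assms(2) by (intro psubset_card_mono) auto
  moreover have no_loop: "{a \<in> A. en f = {a}} = {}" using assms(2) by auto
  ultimately show ?thesis using assms(1) unfolding no_loop by auto
qed

text \<open>In \<open>sum_deg\<close>, an edge inside \<open>A\<close> contributes 2, loop-edges
  included; an edge not inside \<open>A\<close> contributes at most 1, and one that misses
  \<open>A\<close> nothing.\<close>

lemma sum_deg_le:
  assumes "proper_ends en C" "finite A" "finite C"
  shows "(\<Sum>a\<in>A. deg en C a) \<le> 2 * card {f \<in> C. en f \<inter> A \<noteq> {}}"
    and "f \<in> C \<Longrightarrow> en f \<inter> A \<noteq> {} \<Longrightarrow> \<not> en f \<subseteq> A \<Longrightarrow>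
      (\<Sum>a\<in>A. deg en C a) < 2 * card {f \<in> C. en f \<inter> A \<noteq> {}}"
proof -
  let ?w = "\<lambda>f. card (en f \<inter> A) + card {a \<in> A. en f = {a}}"
  let ?D = "{f \<in> C. en f \<inter> A \<noteq> {}}"
  have w0: "?w f = 0" if "f \<in> C - ?D" for f
  proof -
    have "en f \<inter> A = {}" and no_loop: "{a \<in> A. en f = {a}} = {}" using that by auto
    then show ?thesis unfolding no_loop by simp
  qed
  have eq: "(\<Sum>a\<in>A. deg en C a) = sum ?w ?D"
    unfolding sum_deg[OF assms(2,3)]
    by (rule sum.mono_neutral_right[OF assms(3)]) (use w0 in blast)+
  have ends: "card (en f) = 1 \<or> card (en f) = 2" if "f \<in> C" for f
    using assms(1) that by (simp add: proper_ends_def)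
  have w2: "?w f \<le> 2" if "f \<in> ?D" for f
  proof (cases "en f \<subseteq> A")
    case True
    show ?thesis using end_count_inside[of en f A] ends[of f] True that by simp
  next
    case False
    have "?w f \<le> 1" using end_count_crossing[of en f A] ends[of f] False that by simp
    then show ?thesis by linarith
  qed
  have "sum ?w ?D \<le> (\<Sum>f\<in>?D. 2)" by (rule sum_mono) (rule w2)
  then show "(\<Sum>a\<in>A. deg en C a) \<le> 2 * card ?D" by (simp add: eq)
  assume f: "f \<in> C" "en f \<inter> A \<noteq> {}" "\<not> en f \<subseteq> A"
  then have "f \<in> ?D" "?w f < 2" using end_count_crossing[of en f A] ends[OF f(1)] by auto
  moreover have "finite ?D" using assms(3) by simp
  ultimately have "sum ?w ?D < (\<Sum>f\<in>?D. 2)"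
    using w2 by (intro sum_strict_mono_ex1) blast+
  then show "(\<Sum>a\<in>A. deg en C a) < 2 * card ?D" by (simp add: eq)
qed

lemma sum_deg_cover:
  assumes "proper_ends en C" "finite C" "finite A" "\<Union>(en ` C) \<subseteq> A"
  shows "(\<Sum>a\<in>A. deg en C a) = 2 * card C"
proof -
  have "(\<Sum>a\<in>A. deg en C a) = (\<Sum>f\<in>C. 2)"
    unfolding sum_deg[OF assms(3,2)] using assms
    by (intro sum.cong end_count_inside) (auto simp: proper_ends_def)
  then show ?thesis by simp
qed

lemma deg_pos: "finite C \<Longrightarrow> a \<in> \<Union>(en ` C) \<Longrightarrow> deg en C a \<ge> 1"
  by (auto simp: deg_def card_gt_0_iff Suc_le_eq)

text \<open>Each vertex of \<open>A\<close> has degree at least 2, and each edge meeting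
  \<open>A\<close> contributes at most 2 to the degree sum over \<open>A\<close>.\<close>

lemma leafless_count:
  assumes "proper_ends en C" "finite C" "\<And>a. deg en C a \<noteq> 1" "A \<subseteq> \<Union>(en ` C)"
  shows "card A \<le> card {f \<in> C. en f \<inter> A \<noteq> {}}"
proof -
  have fin: "finite A" by (rule finite_subset[OF assms(4) finite_cover[OF assms(1,2)]])
  have "deg en C a \<ge> 2" if "a \<in> A" for a
    using deg_pos[OF assms(2), of a en] assms(3)[of a] subsetD[OF assms(4) that] by linarith
  then have "(\<Sum>a\<in>A. 2) \<le> (\<Sum>a\<in>A. deg en C a)" by (intro sum_mono) auto
  then show ?thesis using sum_deg_le(1)[OF assms(1) fin assms(2)] by simp
qed

text \<open>The bound is strict here because the crossing edge \<open>f\<close> contributes at most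
  1 to the degree sum.\<close>

lemma leafless_crossing_count:
  assumes "proper_ends en C" "finite C" "\<And>a. deg en C a \<noteq> 1" "A \<subseteq> \<Union>(en ` C)"
    and "f \<in> C" "en f \<inter> A \<noteq> {}" "\<not> en f \<subseteq> A"
  shows "card A < card {f \<in> C. en f \<inter> A \<noteq> {}}"
proof -
  have fin: "finite A" using finite_cover[OF assms(1,2)] assms(4) finite_subset by auto
  have "deg en C a \<ge> 2" if "a \<in> A" for a
    using deg_pos[OF assms(2), of a en] assms(3)[of a] assms(4) that by fastforce
  then have "(\<Sum>a\<in>A. 2) \<le> (\<Sum>a\<in>A. deg en C a)" by (intro sum_mono) auto
  then show ?thesis using sum_deg_le(2)[OF assms(1) fin assms(2) assms(5-7)] by simp
qed

lemma deg_1_imp_leaf: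
  assumes "finite C" "deg en C a = 1"
  obtains f where "{f \<in> C. a \<in> en f} = {f}" "en f \<noteq> {a}"
proof -
  have "card {f \<in> C. en f = {a}} \<le> card {f \<in> C. a \<in> en f}"
    using assms by (intro card_mono) auto
  then have *: "card {f \<in> C. a \<in> en f} = 1" "card {f \<in> C. en f = {a}} = 0"
    using assms(2) by (auto simp: deg_def)
  then obtain f where f: "{f \<in> C. a \<in> en f} = {f}" by (metis card_1_singletonE)
  have "{f \<in> C. en f = {a}} = {}" using * assms(1) by simp
  then show ?thesis using f that[of f] by auto
qed

text \<open>A minimal nonempty set with at least as many edges as vertices is a cycle.\<close>

lemma ex_cyclic_subset:
  assumes "proper_ends en Y" "finite Y" "Y \<noteq> {}" "card (\<Union>(en ` Y)) \<le> card Y"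
  obtains D where "D \<subseteq> Y" "D \<noteq> {}" "\<And>a. a \<in> \<Union>(en ` D) \<Longrightarrow> deg en D a = 2"
    "linked en D (\<Union>(en ` D))"
proof -
  let ?S = "{D. D \<subseteq> Y \<and> D \<noteq> {} \<and> card (\<Union>(en ` D)) \<le> card D}"
  have "finite ?S" "Y \<in> ?S" using assms by auto
  from finite_has_minimal2[OF this]
  obtain D where D: "D \<in> ?S" and minD: "\<forall>D'\<in>?S. D' \<subseteq> D \<longrightarrow> D = D'" by auto
  let ?V = "\<Union>(en ` D)"
  have pD: "proper_ends en D" by (rule proper_ends_subset[OF assms(1)]) (use D in simp)
  have finD: "finite D" by (rule finite_subset[OF _ assms(2)]) (use D in simp)
  have finV: "finite ?V" by (rule finite_cover[OF pD finD])
  have small: "card D' < card (\<Union>(en ` D'))" if "D' \<subset> D" "D' \<noteq> {}" for D'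
  proof (rule ccontr)
    assume "\<not> card D' < card (\<Union>(en ` D'))"
    then have "D' \<in> ?S" using that D by auto
    then show False using minD that by blast
  qed
  have remove: "card D \<le> card (\<Union>(en ` (D - {f})))" if "f \<in> D" "D \<noteq> {f}" for f
  proof -
    have "D - {f} \<subset> D" "D - {f} \<noteq> {}" using that by auto
    then show ?thesis using small[of "D - {f}"] that finD by simp
  qed
  \<comment> \<open>An excess of edges over vertices would leave a smaller set of the same kind
    after the removal of one edge, against minimality.\<close>
  have card_eq: "card D = card ?V"
  proof (rule ccontr)
    assume "card D \<noteq> card ?V"
    then have lt: "card ?V < card D" using D by auto
    obtain f where f: "f \<in> D" using D by auto
    have "en f \<noteq> {}" using proper_ends_nonempty[OF pD f] .
    then have "card ?V > 0" using finV f by (auto simp: card_gt_0_iff)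
    then have "D \<noteq> {f}" using lt by auto
    moreover have "card (\<Union>(en ` (D - {f}))) \<le> card ?V" using finV by (intro card_mono) auto
    ultimately show False using remove[OF f] lt by auto
  qed
  \<comment> \<open>Removing the edge at a leaf \<open>a\<close> also loses the vertex
    \<open>a\<close>, which leaves fewer than \<open>card D\<close> vertices, against
    \<open>remove\<close>. If \<open>D\<close> is a single edge, \<open>card_eq\<close> makes it a
    loop-edge.\<close>
  have no_leaf: "deg en D a \<noteq> 1" for a
  proof
    assume "deg en D a = 1"
    then obtain f where f: "{f \<in> D. a \<in> en f} = {f}" "en f \<noteq> {a}" by (rule deg_1_imp_leaf[OF finD])
    then have fD: "f \<in> D" "a \<in> en f" by auto
    show False
    proof (cases "D = {f}")
      case True
      then have "?V = en f" "card (en f) = 1" using card_eq by auto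
      then show False using f(2) fD by (metis card_1_singletonE singletonD)
    next
      case False
      have "\<Union>(en ` (D - {f})) \<subseteq> ?V - {a}" using f(1) by blast
      then have "card (\<Union>(en ` (D - {f}))) \<le> card (?V - {a})" using finV by (intro card_mono) auto
      also have "\<dots> < card ?V" using finV fD by (intro psubset_card_mono) auto
      finally show False using remove[OF fD(1) False] card_eq by auto
    qed
  qed
  have ge2: "deg en D a \<ge> 2" if "a \<in> ?V" for a
    using deg_pos[OF finD that] no_leaf[of a] by auto
  \<comment> \<open>The degrees are at least 2 and sum to \<open>2 * card D = 2 * card ?V\<close>,
    so none exceeds 2.\<close>
  have deg2: "deg en D a = 2" if a: "a \<in> ?V" for a
  proof (rule ccontr)
    assume "deg en D a \<noteq> 2"
    then have "2 < deg en D a" using ge2[OF a] by auto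
    then have "(\<Sum>a\<in>?V. 2) < (\<Sum>a\<in>?V. deg en D a)"
      using ge2 a finV by (intro sum_strict_mono_ex1) auto
    then show False using sum_deg_cover[OF pD finD finV] card_eq by simp
  qed
  have "linked en D ?V"
    unfolding linked_def
  proof (intro allI impI, rule ccontr, elim conjE)
    fix T assume T: "T \<subset> ?V" "T \<noteq> {}"
      and nocross: "\<not> (\<exists>f\<in>D. en f \<subseteq> ?V \<and> en f \<inter> T \<noteq> {} \<and> \<not> en f \<subseteq> T)"
    \<comment> \<open>A set \<open>T\<close> crossed by no edge would split \<open>D\<close> into
      two parts with disjoint vertex sets, each with fewer edges than vertices, against
      \<open>card_eq\<close>.\<close>
    define D1 where "D1 = {f \<in> D. en f \<subseteq> T}"
    define D2 where "D2 = {f \<in> D. en f \<inter> T = {}}"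
    have D12: "D = D1 \<union> D2" "D1 \<inter> D2 = {}"
      using nocross proper_ends_nonempty[OF pD] unfolding D1_def D2_def by blast+
    have ne: "D1 \<noteq> {}" "D2 \<noteq> {}" using T nocross unfolding D1_def D2_def by blast+
    have V12: "?V = \<Union>(en ` D1) \<union> \<Union>(en ` D2)" "\<Union>(en ` D1) \<inter> \<Union>(en ` D2) = {}"
      using D12 unfolding D1_def D2_def by blast+
    have "card D1 < card (\<Union>(en ` D1))" "card D2 < card (\<Union>(en ` D2))"
      using D12 ne by (intro small; blast)+
    moreover have "card D = card D1 + card D2"
      using D12 finD by (metis card_Un_disjoint finite_Un)
    moreover have "card ?V = card (\<Union>(en ` D1)) + card (\<Union>(en ` D2))"
      using V12 finV by (metis card_Un_disjoint finite_Un)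
    ultimately show False using card_eq by linarith
  qed
  then show ?thesis using that[of D] D deg2 by auto
qed

section \<open>Cycles as dense edge sets\<close>

lemma cycle_iff:
  "cycle G C \<longleftrightarrow> C \<subseteq> edges G \<and> (\<Union>(ends G ` C)) \<noteq> {} \<and>
     (\<forall>u \<in> \<Union>(ends G ` C). \<Union>(ends G ` C) \<subseteq> reach (ends G) C u) \<and>
     (\<forall>u \<in> \<Union>(ends G ` C). deg (ends G) C u = 2)"
  unfolding cycle_def connected_graph_reach degree_def loops_def deg_def edge_subgraph_def by simp

lemma (in graph) proper: "proper_ends (ends G) (edges G)"
  using card_ends by (auto simp: proper_ends_def)

text \<open>Replaces cycles by a count of edges against vertices, which can be compared with matroid
  rank. A cycle has equally many of both, by its degree sum.\<close>

lemma (in graph) contains_cycle_iff: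
  assumes "Y \<subseteq> edges G"
  shows "(\<exists>C. cycle G C \<and> C \<subseteq> Y) \<longleftrightarrow>
    (\<exists>D. D \<subseteq> Y \<and> D \<noteq> {} \<and> card (\<Union>(ends G ` D)) \<le> card D)"
proof
  assume "\<exists>C. cycle G C \<and> C \<subseteq> Y"
  then obtain C where C: "cycle G C" "C \<subseteq> Y" by auto
  then have "C \<subseteq> edges G" using assms by simp
  then have pC: "proper_ends (ends G) C" and fC: "finite C"
    by (rule proper_ends_subset[OF proper], rule finite_subset[OF _ finite_edges])
  have deg2: "\<forall>u\<in>\<Union>(ends G ` C). deg (ends G) C u = 2" using C(1) unfolding cycle_iff by blast
  have "(\<Sum>a\<in>\<Union>(ends G ` C). deg (ends G) C a) = (\<Sum>a\<in>\<Union>(ends G ` C). 2)"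
    by (rule sum.cong[OF refl]) (rule deg2[rule_format])
  then have "card (\<Union>(ends G ` C)) = card C"
    using sum_deg_cover[OF pC fC finite_cover[OF pC fC]] by simp
  moreover have "C \<noteq> {}" using C(1) unfolding cycle_iff by blast
  ultimately show "\<exists>D. D \<subseteq> Y \<and> D \<noteq> {} \<and> card (\<Union>(ends G ` D)) \<le> card D"
    using C(2) by (intro exI[of _ C]) simp
next
  assume "\<exists>D. D \<subseteq> Y \<and> D \<noteq> {} \<and> card (\<Union>(ends G ` D)) \<le> card D"
  then obtain D where D: "D \<subseteq> Y" "D \<noteq> {}" "card (\<Union>(ends G ` D)) \<le> card D" by auto
  then have "D \<subseteq> edges G" using assms by simp
  then have "proper_ends (ends G) D" "finite D"
    by (rule proper_ends_subset[OF proper], rule finite_subset[OF _ finite_edges])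
  then obtain C where C: "C \<subseteq> D" "C \<noteq> {}" "linked (ends G) C (\<Union>(ends G ` C))"
    and deg2: "\<And>a. a \<in> \<Union>(ends G ` C) \<Longrightarrow> deg (ends G) C a = 2"
    using ex_cyclic_subset[OF _ _ D(2,3)] by (metis (no_types, lifting))
  have CY: "C \<subseteq> edges G" using C(1) D(1) assms by simp
  have pC: "proper_ends (ends G) C" by (rule proper_ends_subset[OF proper CY])
  have "\<Union>(ends G ` C) \<noteq> {}" using C(2) proper_ends_nonempty[OF pC] by blast
  then have "cycle G C" unfolding cycle_iff
    using CY deg2 linked_subset_reach[OF pC C(3)] by blast
  then show "\<exists>C. cycle G C \<and> C \<subseteq> Y" using C(1) D(1) by blast
qed

section \<open>Rank and circuits in a framework\<close>

context graph
begin

lemma component_reach: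
  assumes "a \<in> verts G"
  defines "R \<equiv> reach (ends G) (edges G) a"
  shows "component G \<lparr>verts = R, edges = within (ends G) (edges G) R, ends = ends G\<rparr>"
proof -
  let ?K = "\<lparr>verts = R, edges = within (ends G) (edges G) R, ends = ends G\<rparr>"
  have RV: "R \<subseteq> verts G"
    unfolding R_def using assms(1) ends_subset_verts by (intro reach_least) auto
  have "graph ?K"
    using finite_subset[OF RV finite_verts] finite_edges card_ends
    by unfold_locales (auto simp: within_def)
  then have "subgraph ?K G" using RV by (auto simp: subgraph_def within_def)
  moreover have "connected_graph ?K"
  proof -
    have "linked (ends G) (within (ends G) (edges G) R) R"
      unfolding R_def by (intro linked_within linked_reach proper)
    then have "R \<subseteq> reach (ends G) (within (ends G) (edges G) R) u" if "u \<in> R" for u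
      using that by (intro linked_subset_reach proper_ends_subset[OF proper]) (auto simp: within_def)
    moreover have "a \<in> R" unfolding R_def by (rule reach_refl)
    ultimately show ?thesis by (auto simp: connected_graph_reach)
  qed
  moreover have "H = ?K" if H: "subgraph H G" "connected_graph H" "subgraph ?K H" for H
  proof -
    interpret H: graph H using H(1) by (simp add: subgraph_def)
    have RH: "R \<subseteq> verts H" and ends_H: "ends H = ends G" and EH: "edges H \<subseteq> edges G"
      and KH: "within (ends G) (edges G) R \<subseteq> edges H"
      using H by (auto simp: subgraph_def)
    have "a \<in> verts H" using RH reach_refl[of a] unfolding R_def by auto
    then have "verts H \<subseteq> reach (ends G) (edges H) a"
      using H(2) by (simp add: connected_graph_reach ends_H)
    also have "\<dots> \<subseteq> R" unfolding R_def
      using EH by (intro reach_least reach_refl reach_closed[OF proper]) auto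
    finally have VH: "verts H = R" using RH by auto
    have "edges H \<subseteq> within (ends G) (edges G) R"
      using EH H.ends_subset_verts VH ends_H by (auto simp: within_def)
    then have "edges H = within (ends G) (edges G) R" using KH by auto
    then show ?thesis using VH ends_H by (intro pre_graph.equality) auto
  qed
  ultimately show ?thesis unfolding component_def by auto
qed

text \<open>A component is determined by its vertices and edges. Finiteness matters because
  \<open>card\<close> of an infinite set is 0, so that three components would not by themselves
  contradict a bound of 2.\<close>

lemma finite_components: "finite {H. component G H}"
proof (rule finite_subset)
  let ?mk = "\<lambda>(A, F). \<lparr>verts = A, edges = F, ends = ends G\<rparr>"
  show "{H. component G H} \<subseteq> ?mk ` (Pow (verts G) \<times> Pow (edges G))"
  proof
    fix H assume "H \<in> {H. component G H}"
    then have H: "verts H \<subseteq> verts G" "edges H \<subseteq> edges G" "ends H = ends G"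
      by (auto simp: component_def subgraph_def)
    then have "H = ?mk (verts H, edges H)" by (auto intro: pre_graph.equality)
    then show "H \<in> ?mk ` (Pow (verts G) \<times> Pow (edges G))" using H by blast
  qed
  show "finite (?mk ` (Pow (verts G) \<times> Pow (edges G)))"
    using finite_verts finite_edges by simp
qed

lemma graph_edge_subgraph:
  assumes "X \<subseteq> edges G" shows "graph (edge_subgraph G X)"
proof
  have fin: "finite X" using assms finite_edges by (rule finite_subset)
  then show "finite (verts (edge_subgraph G X))" "finite (edges (edge_subgraph G X))"
    using finite_cover[OF proper_ends_subset[OF proper assms] fin]
    by (simp_all add: edge_subgraph_def)
next
  fix e assume "e \<in> edges (edge_subgraph G X)"
  then show "ends (edge_subgraph G X) e \<subseteq> verts (edge_subgraph G X)"
    "card (ends (edge_subgraph G X) e) = 1 \<or> card (ends (edge_subgraph G X) e) = 2"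
    using assms card_ends by (auto simp: edge_subgraph_def)
qed

end

section \<open>Rank bounds and the shape of circuits in a framework\<close>

locale framework_graph = matroid M + graph G
  for M :: "'e pre_matroid" and G :: "('v, 'e) pre_graph" +
  assumes framework: "framework G M"
begin

abbreviation vertices_of :: "'e set \<Rightarrow> 'v set" where
  "vertices_of X \<equiv> \<Union>(ends G ` X)"

abbreviation inside :: "'v set \<Rightarrow> 'e set" where
  "inside B \<equiv> within (ends G) (edges G) B"

lemma ground_eq: "ground M = edges G"
  using framework by (simp add: framework_def)

lemma proper_subset: "X \<subseteq> edges G \<Longrightarrow> proper_ends (ends G) X"
  by (rule proper_ends_subset[OF proper])

lemma vertices_of_subset: "X \<subseteq> edges G \<Longrightarrow> vertices_of X \<subseteq> verts G"
  using ends_subset_verts by auto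

lemma finite_vertices_of: "X \<subseteq> edges G \<Longrightarrow> finite (vertices_of X)"
  by (rule finite_subset[OF vertices_of_subset finite_verts])

lemma circuit_edges: "circuit M C \<Longrightarrow> C \<subseteq> edges G"
  by (simp add: circuit_def ground_eq)

text \<open>The form in which the closure condition of a framework is used: \<open>X\<close> avoids
  \<open>w\<close>, so its closure contains no edge at \<open>w\<close> except loop-edges.\<close>

lemma leaf_notin_cl:
  assumes "f \<in> edges G" "w \<in> ends G f" "ends G f \<noteq> {w}" "X \<subseteq> edges G"
    and "\<And>x. x \<in> X \<Longrightarrow> w \<notin> ends G x"
  shows "f \<notin> cl M X"
proof
  assume "f \<in> cl M X"
  moreover have "cl M X \<subseteq> cl M (edges (delete_vertex G w))"
    using assms(4,5) by (intro cl_mono) (auto simp: delete_vertex_def)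
  moreover have "w \<in> verts G" using assms(1,2) ends_subset_verts by auto
  then have "cl M (edges (delete_vertex G w)) \<subseteq> edges (delete_vertex G w) \<union> loops G w"
    using framework by (simp add: framework_def)
  ultimately show False using assms(2,3) by (auto simp: delete_vertex_def loops_def)
qed

lemma rank_insert_leaf:
  assumes "f \<in> edges G" "w \<in> ends G f" "ends G f \<noteq> {w}" "X \<subseteq> edges G"
    and "\<And>x. x \<in> X \<Longrightarrow> w \<notin> ends G x"
  shows "rank M (insert f X) = rank M X + 1"
  using leaf_notin_cl[OF assms] rank_insert_notin_cl assms(1) by (simp add: ground_eq)

text \<open>Such a \<open>B\<close> is a union of components; their rank bounds are added by
  splitting off one component at a time.\<close>

lemma rank_inside_closed:
  assumes "B \<subseteq> verts G" "\<And>f. f \<in> edges G \<Longrightarrow> ends G f \<inter> B \<noteq> {} \<Longrightarrow> ends G f \<subseteq> B"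
  shows "rank M (inside B) \<le> card B"
  using assms
proof (induction "card B" arbitrary: B rule: less_induct)
  case less
  show ?case
  proof (cases "B = {}")
    case True
    then have "inside B = {}" using proper_ends_nonempty[OF proper] by (auto simp: within_def)
    then show ?thesis using rank_le_card[of "{}"] by simp
  next
    case False
    then obtain a where a: "a \<in> B" by auto
    let ?R = "reach (ends G) (edges G) a"
    have RB: "?R \<subseteq> B" by (rule reach_least[OF a]) (rule less.prems(2))
    have finB: "finite B" using less.prems(1) finite_verts finite_subset by auto
    have "component G \<lparr>verts = ?R, edges = inside ?R, ends = ends G\<rparr>"
      using a less.prems(1) by (intro component_reach) auto
    then have rank_R: "rank M (inside ?R) \<le> card ?R"
      using framework unfolding framework_def by fastforce
    have sub: "B - ?R \<subset> B" using a reach_refl[of a "ends G" "edges G"] by auto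
    have "rank M (inside (B - ?R)) \<le> card (B - ?R)"
    proof (rule less.hyps)
      show "card (B - ?R) < card B" using sub finB by (rule psubset_card_mono[rotated])
      show "B - ?R \<subseteq> verts G" using less.prems(1) by auto
      fix f assume f: "f \<in> edges G" "ends G f \<inter> (B - ?R) \<noteq> {}"
      then have "ends G f \<subseteq> B" using less.prems(2)[of f] by auto
      moreover have "ends G f \<inter> ?R = {}" using reach_closed[OF proper f(1), of a] f(2) by auto
      ultimately show "ends G f \<subseteq> B - ?R" by auto
    qed
    moreover have "inside B \<subseteq> inside ?R \<union> inside (B - ?R)"
      using reach_closed[OF proper, of _ a] unfolding within_def by blast
    then have "rank M (inside B) \<le> rank M (inside ?R) + rank M (inside (B - ?R))"
      using rank_mono rank_Un_le order_trans by blast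
    moreover have "card ?R + card (B - ?R) = card B"
      using RB finB by (metis card_Diff_subset card_mono finite_subset le_add_diff_inverse)
    ultimately show ?thesis using rank_R by linarith
  qed
qed

text \<open>For a union of components the bound is condition (2); a vertex set that is no such union can be
  enlarged by a vertex, which by condition (3) increases the rank by at least one.\<close>

lemma rank_inside_le:
  assumes "B \<subseteq> verts G" shows "rank M (inside B) \<le> card B"
  using assms
proof (induction "card (verts G - B)" arbitrary: B rule: less_induct)
  case less
  show ?case
  proof (cases "\<forall>f \<in> edges G. ends G f \<inter> B \<noteq> {} \<longrightarrow> ends G f \<subseteq> B")
    case True
    then show ?thesis using rank_inside_closed less.prems by blast
  next
    case False
    then obtain f where f: "f \<in> edges G" "ends G f \<inter> B \<noteq> {}" "\<not> ends G f \<subseteq> B" by blast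
    obtain x y where xy: "ends G f = {x, y}" by (rule proper_endsE[OF proper f(1)])
    obtain w where w: "w \<in> ends G f" "w \<notin> B" using f(3) by blast
    have fw: "ends G f \<noteq> {w}" "ends G f \<subseteq> insert w B" using w f(2) xy by auto
    have wV: "w \<in> verts G" using w f(1) ends_subset_verts by auto
    have finB: "finite B" using less.prems finite_verts finite_subset by auto
    have "rank M (inside (insert w B)) \<le> card (insert w B)"
    proof (rule less.hyps)
      show "insert w B \<subseteq> verts G" using wV less.prems by simp
      show "card (verts G - insert w B) < card (verts G - B)"
        using wV w(2) finite_verts by (intro psubset_card_mono) auto
    qed
    moreover have "rank M (insert f (inside B)) = rank M (inside B) + 1"
      using w fw f(1) by (intro rank_insert_leaf[of f w]) (auto simp: within_def)
    moreover have "rank M (insert f (inside B)) \<le> rank M (inside (insert w B))"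
      using fw f(1) by (intro rank_mono) (auto simp: within_def)
    ultimately show ?thesis using w(2) finB by simp
  qed
qed

lemma rank_le_vertices:
  assumes "X \<subseteq> edges G" shows "rank M X \<le> card (vertices_of X)"
proof -
  have "rank M X \<le> rank M (inside (vertices_of X))"
    using assms by (intro rank_mono) (auto simp: within_def)
  also have "\<dots> \<le> card (vertices_of X)" by (rule rank_inside_le[OF vertices_of_subset[OF assms]])
  finally show ?thesis .
qed

text \<open>The vertices of \<open>A - B\<close> are added one at a time along edges inside
  \<open>A\<close> that leave the current set. Nothing collected so far meets the new end
  \<open>w\<close>, so the closure condition makes each such edge raise the rank. Played against
  \<open>rank_inside_le\<close>, this lower bound drives the later rank arguments.\<close>

lemma rank_growth:
  assumes "linked (ends G) (edges G) A" "finite A" "B \<subseteq> A" "B \<noteq> {}" "X \<subseteq> edges G"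
    and "\<And>x. x \<in> X \<Longrightarrow> ends G x \<inter> (A - B) = {}"
  shows "rank M X + card (A - B) \<le> rank M (X \<union> inside A)"
  using assms(3-6)
proof (induction "card (A - B)" arbitrary: B X rule: less_induct)
  case less
  show ?case
  proof (cases "B = A")
    case True
    then show ?thesis using rank_mono[of X "X \<union> inside A"] by simp
  next
    case False
    then have "B \<subset> A" using less.prems(1) by auto
    from linkedE[OF assms(1) this less.prems(2)] obtain f where
      f: "f \<in> edges G" "ends G f \<subseteq> A" "ends G f \<inter> B \<noteq> {}" "\<not> ends G f \<subseteq> B" .
    obtain x y where xy: "ends G f = {x, y}" by (rule proper_endsE[OF proper f(1)])
    obtain w where w: "w \<in> ends G f" "w \<notin> B" using f(4) by blast
    have fw: "ends G f \<noteq> {w}" "ends G f \<subseteq> insert w B" "w \<in> A" using w f(2,3) xy by auto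
    have card_Suc: "card (A - B) = Suc (card (A - insert w B))"
      using w(2) fw(3) assms(2) by (metis Diff_iff Diff_insert card_Suc_Diff1 finite_Diff)
    have "rank M (insert f X) + card (A - insert w B) \<le> rank M (insert f X \<union> inside A)"
    proof (rule less.hyps)
      show "card (A - insert w B) < card (A - B)" using card_Suc by simp
      show "insert w B \<subseteq> A" using fw less.prems by auto
      show "insert f X \<subseteq> edges G" using f less.prems by auto
      show "ends G x \<inter> (A - insert w B) = {}" if "x \<in> insert f X" for x
        using that less.prems(4)[of x] fw(2) by auto
    qed simp
    moreover have "w \<notin> ends G x" if "x \<in> X" for x
      using less.prems(4)[OF that] w(2) fw(3) by blast
    then have "rank M (insert f X) = rank M X + 1"
      by (rule rank_insert_leaf[OF f(1) w(1) fw(1) less.prems(3)])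
    moreover have "insert f X \<union> inside A = X \<union> inside A" using f by (auto simp: within_def)
    ultimately show ?thesis using card_Suc by simp
  qed
qed

text \<open>The edge at a leaf would lie outside the closure of the other elements, whereas a
  circuit element is spanned by the rest of its circuit.\<close>

lemma circuit_leafless:
  assumes "circuit M C" shows "deg (ends G) C a \<noteq> 1"
proof
  assume "deg (ends G) C a = 1"
  then obtain f where f: "{f \<in> C. a \<in> ends G f} = {f}" "ends G f \<noteq> {a}"
    by (rule deg_1_imp_leaf[OF circuit_finite[OF assms]])
  then have "f \<in> C" "a \<in> ends G f" by auto
  then have "f \<notin> cl M (C - {f})"
    using f circuit_edges[OF assms] by (intro leaf_notin_cl[of f a]) auto
  then show False using circuit_in_cl[OF assms \<open>f \<in> C\<close>] by simp
qed

text \<open>A set \<open>T\<close> crossed by no edge of \<open>C1\<close> would give at least three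
  components: one in \<open>T\<close>, one in the rest of \<open>C1\<close> and one in
  \<open>C2\<close>.\<close>

lemma circuit_part_linked:
  assumes C: "circuit M (C1 \<union> C2)" and disj: "vertices_of C1 \<inter> vertices_of C2 = {}"
    and ne: "C2 \<noteq> {}"
  shows "linked (ends G) C1 (vertices_of C1)"
  unfolding linked_def
proof (intro allI impI, rule ccontr, elim conjE)
  fix T assume T: "T \<subset> vertices_of C1" "T \<noteq> {}"
    and nocross: "\<not> (\<exists>f\<in>C1. ends G f \<subseteq> vertices_of C1 \<and> ends G f \<inter> T \<noteq> {} \<and> \<not> ends G f \<subseteq> T)"
  let ?C = "C1 \<union> C2"
  let ?H = "edge_subgraph G ?C"
  have CE: "?C \<subseteq> edges G" by (rule circuit_edges[OF C])
  interpret H: graph ?H by (rule graph_edge_subgraph[OF CE])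
  have pC2: "proper_ends (ends G) C2" using CE by (intro proper_subset) auto
  obtain a where a: "a \<in> T" using T by auto
  obtain b where b: "b \<in> vertices_of C1 - T" using T by auto
  obtain c where c: "c \<in> vertices_of C2" using ne proper_ends_nonempty[OF pC2] by blast
  let ?R = "reach (ends G) ?C"
  have Ra: "?R a \<subseteq> T"
  proof (rule reach_least[OF a])
    fix f assume "f \<in> ?C" "ends G f \<inter> T \<noteq> {}"
    moreover from this have "f \<in> C1" using T disj by blast
    ultimately show "ends G f \<subseteq> T" using nocross by blast
  qed
  have Rb: "?R b \<subseteq> vertices_of C1 - T"
  proof (rule reach_least[OF b])
    fix f assume f: "f \<in> ?C" "ends G f \<inter> (vertices_of C1 - T) \<noteq> {}"
    then have "f \<in> C1" using disj by blast
    then show "ends G f \<subseteq> vertices_of C1 - T" using nocross f by blast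
  qed
  have Rc: "?R c \<subseteq> vertices_of C2"
    by (rule reach_least[OF c]) (use disj in blast)
  define K where "K u = \<lparr>verts = ?R u, edges = within (ends G) ?C (?R u), ends = ends G\<rparr>" for u
  have comp: "component ?H (K u)" if "u \<in> vertices_of ?C" for u
    using H.component_reach[of u] that unfolding K_def by (simp add: edge_subgraph_def)
  have "a \<in> vertices_of ?C" "b \<in> vertices_of ?C" "c \<in> vertices_of ?C" using a b c T by auto
  then have "{K a, K b, K c} \<subseteq> {H. component ?H H}" using comp by auto
  then have "card {K a, K b, K c} \<le> card {H. component ?H H}"
    by (rule card_mono[OF H.finite_components])
  moreover have "card {H. component ?H H} \<le> 2" using framework C by (simp add: framework_def)
  moreover have "?R a \<noteq> ?R b" "?R a \<noteq> ?R c" "?R b \<noteq> ?R c"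
    using Ra Rb Rc T disj reach_refl[of a "ends G" ?C] reach_refl[of b "ends G" ?C] by blast+
  then have "K a \<noteq> K b" "K a \<noteq> K c" "K b \<noteq> K c" by (auto simp: K_def)
  then have "card {K a, K b, K c} = 3" by simp
  ultimately show False by linarith
qed

end

section \<open>Frameworks with connected circuits\<close>

context framework_graph
begin

definition frame_ends :: "(nat \<Rightarrow> 'v) \<Rightarrow> 'e + nat \<Rightarrow> 'v set" where
  "frame_ends h = case_sum (ends G) (\<lambda>n. {h n})"

text \<open>Attach a new loop-edge \<open>Inr n\<close> at the vertex \<open>h n\<close>. A set is independent in the frame matroid of the
  enlarged graph iff its old part is independent in \<open>M\<close> and it is independent in the bicircular
  matroid, that is, no vertex set contains more edges than it has vertices.\<close>

definition frame_extension :: "(nat \<Rightarrow> 'v) \<Rightarrow> nat set \<Rightarrow> ('e + nat) pre_matroid" where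
  "frame_extension h N = \<lparr>ground = Inl ` ground M \<union> Inr ` N,
     indeps = {J. J \<subseteq> Inl ` ground M \<union> Inr ` N \<and> Inl -` J \<in> indeps M \<and>
       (\<forall>B \<subseteq> verts G. card (within (frame_ends h) J B) \<le> card B)}\<rparr>"

lemma frame_ends_simps [simp]:
  "frame_ends h (Inl x) = ends G x" "frame_ends h (Inr n) = {h n}"
  by (simp_all add: frame_ends_def)

context
  fixes h :: "nat \<Rightarrow> 'v" and N :: "nat set"
  assumes h: "bij_betw h N (verts G)"
    and circuits_linked: "\<And>C. circuit M C \<Longrightarrow> linked (ends G) C (vertices_of C)"
begin

abbreviation "ext \<equiv> frame_extension h N"
abbreviation "inner J B \<equiv> within (frame_ends h) J B"

section \<open>The frame extension is a matroid\<close>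

lemma finite_N: "finite N"
  using bij_betw_finite[OF h] finite_verts by simp

lemma finite_ext_ground: "finite (ground ext)"
  using finite_N finite_ground by (simp add: frame_extension_def)

lemma ext_indep_iff: "J \<in> indeps ext \<longleftrightarrow> J \<subseteq> ground ext \<and> Inl -` J \<in> indeps M \<and>
    (\<forall>B \<subseteq> verts G. card (inner J B) \<le> card B)"
  by (simp add: frame_extension_def)

lemma finite_ext_indep: "J \<in> indeps ext \<Longrightarrow> finite J"
  by (rule finite_subset[OF _ finite_ext_ground]) (simp add: ext_indep_iff)

lemma ext_indep_subset:
  assumes "J \<in> indeps ext" "K \<subseteq> J" shows "K \<in> indeps ext"
  unfolding ext_indep_iff
proof (intro conjI allI impI)
  show "K \<subseteq> ground ext" using assms by (auto simp: ext_indep_iff)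
  show "Inl -` K \<in> indeps M"
    using assms indep_subset[of "Inl -` J" "Inl -` K"] by (auto simp: ext_indep_iff)
  fix B assume B: "B \<subseteq> verts G"
  have "card (inner K B) \<le> card (inner J B)"
    using finite_ext_indep[OF assms(1)] assms(2) by (intro card_mono) (auto simp: within_def)
  also have "\<dots> \<le> card B" using assms(1) B by (simp add: ext_indep_iff)
  finally show "card (inner K B) \<le> card B" .
qed

lemma ext_ends:
  assumes "y \<in> ground ext" shows "frame_ends h y \<subseteq> verts G" "frame_ends h y \<noteq> {}"
proof -
  have "frame_ends h y \<subseteq> verts G \<and> frame_ends h y \<noteq> {}"
  proof (cases y)
    case (Inl x)
    then have "x \<in> edges G" using assms by (auto simp: frame_extension_def ground_eq)
    then show ?thesis using Inl ends_subset_verts proper_ends_nonempty[OF proper] by simp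
  next
    case (Inr n)
    then have "n \<in> N" using assms by (auto simp: frame_extension_def)
    then show ?thesis using Inr bij_betwE[OF h] by simp
  qed
  then show "frame_ends h y \<subseteq> verts G" "frame_ends h y \<noteq> {}" by auto
qed

text \<open>A vertex set \<open>B\<close> is tight for \<open>X\<close> if it contains as many elements of \<open>X\<close> as it has vertices. Tight sets are closed
  under union.\<close>

lemma maximal_tight_set:
  assumes X: "X \<in> indeps ext"
  obtains T where "T \<subseteq> verts G" "card (inner X T) = card T"
    "\<And>B. B \<subseteq> verts G \<Longrightarrow> card B \<le> card (inner X B) \<Longrightarrow> B \<subseteq> T"
proof -
  let ?S = "{T. T \<subseteq> verts G \<and> card (inner X T) = card T}"
  have "inner X {} = {}" using X ext_ends(2) by (auto simp: within_def ext_indep_iff)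
  then have "finite ?S" "{} \<in> ?S" using finite_verts by auto
  from finite_has_maximal2[OF this]
  obtain T where T: "T \<in> ?S" and maxT: "\<forall>B\<in>?S. T \<subseteq> B \<longrightarrow> T = B" by auto
  have "B \<subseteq> T" if B: "B \<subseteq> verts G" "card B \<le> card (inner X B)" for B
  proof -
    have le: "card (inner X D) \<le> card D" if "D \<subseteq> verts G" for D
      using X that by (simp add: ext_indep_iff)
    have "finite T" "finite B" using T B finite_verts finite_subset by auto
    then have "card (T \<union> B) + card (T \<inter> B) = card T + card B" by (metis card_Un_Int)
    moreover have "card (inner X T) + card (inner X B) \<le> card (inner X (T \<union> B)) + card (inner X (T \<inter> B))"
      by (rule card_within_modular[OF finite_ext_indep[OF X]])
    moreover have "card (inner X (T \<union> B)) \<le> card (T \<union> B)" "card (inner X (T \<inter> B)) \<le> card (T \<inter> B)"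
      using T B by (auto intro!: le)
    ultimately have "card (inner X (T \<union> B)) = card (T \<union> B)" using T B(2) by simp
    then have "T \<union> B \<in> ?S" using T B by auto
    then show ?thesis using maxT by blast
  qed
  then show ?thesis using that[of T] T by auto
qed

text \<open>A circuit through \<open>f\<close> that meets the largest tight set \<open>T\<close> has more edges outside \<open>T\<close> than
  vertices outside \<open>T\<close>, so that adding its vertices to \<open>T\<close> would give a larger tight set.\<close>

lemma blocked_in_closure:
  assumes X: "X \<in> indeps ext" and T: "T \<subseteq> verts G" "card (inner X T) = card T"
    and maxT: "\<And>B. B \<subseteq> verts G \<Longrightarrow> card B \<le> card (inner X B) \<Longrightarrow> B \<subseteq> T"
    and f: "f \<in> ground M" "\<not> ends G f \<subseteq> T" "Inl f \<notin> X" "insert (Inl f) X \<notin> indeps ext"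
  shows "f \<in> cl M {x. Inl x \<in> X \<and> \<not> ends G x \<subseteq> T}"
proof -
  have finX: "finite X" by (rule finite_ext_indep[OF X])
  \<comment> \<open>The ends of \<open>f\<close> do not lie inside \<open>T\<close>, so they lie
    inside no tight set, and adding \<open>f\<close> respects the bicircular bounds. The obstruction
    is therefore dependence in \<open>M\<close>, which yields a circuit through
    \<open>f\<close>.\<close>
  have "card (inner (insert (Inl f) X) B) \<le> card B" if B: "B \<subseteq> verts G" for B
  proof (cases "ends G f \<subseteq> B")
    case True
    then have "\<not> card B \<le> card (inner X B)" using maxT[OF B] f(2) by blast
    moreover have "inner (insert (Inl f) X) B = insert (Inl f) (inner X B)"
      using True by (auto simp: within_def)
    ultimately show ?thesis
      using card_insert_le_m1 finX f(3) by (simp add: within_def)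
  next
    case False
    then have "inner (insert (Inl f) X) B = inner X B" by (auto simp: within_def)
    then show ?thesis using X B by (simp add: ext_indep_iff)
  qed
  moreover have "Inl -` insert (Inl f) X = insert f (Inl -` X)" by auto
  moreover have "Inl f \<in> ground ext" using f(1) by (simp add: frame_extension_def)
  ultimately have "insert f (Inl -` X) \<notin> indeps M" using f(4) X by (simp add: ext_indep_iff)
  moreover have "Inl -` X \<in> indeps M" using X by (simp add: ext_indep_iff)
  ultimately obtain C where C: "circuit M C" "C \<subseteq> insert f (Inl -` X)" "f \<in> C"
    using circuit_through f(1) by metis
  have CE: "C \<subseteq> edges G" by (rule circuit_edges[OF C(1)])
  have pC: "proper_ends (ends G) C" by (rule proper_subset[OF CE])
  have VC: "vertices_of C \<subseteq> verts G" by (rule vertices_of_subset[OF CE])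
  have finV: "finite (vertices_of C)" by (rule finite_vertices_of[OF CE])
  have finT: "finite T" using T(1) finite_verts finite_subset by blast
  have disj: "vertices_of C \<inter> T = {}"
  proof (rule ccontr)
    assume meet: "vertices_of C \<inter> T \<noteq> {}"
    let ?A = "vertices_of C - T"
    have "vertices_of C \<inter> T \<subset> vertices_of C" using C(3) f(2) by blast
    from linkedE[OF circuits_linked[OF C(1)] this meet] obtain g where
      g: "g \<in> C" "ends G g \<inter> (vertices_of C \<inter> T) \<noteq> {}" "\<not> ends G g \<subseteq> vertices_of C \<inter> T" .
    let ?D = "{g \<in> C. ends G g \<inter> ?A \<noteq> {}}"
    have gA: "ends G g \<inter> ?A \<noteq> {}" "\<not> ends G g \<subseteq> ?A" using g by blast+
    have AD: "card ?A < card ?D"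
      by (rule leafless_crossing_count[OF pC circuit_finite[OF C(1)] circuit_leafless[OF C(1)] _ g(1) gA]) auto
    \<comment> \<open>As \<open>f\<close> is not in \<open>X\<close>, only \<open>?D - {f}\<close>
      counts; the strict inequality \<open>AD\<close> makes up for this loss of one.\<close>
    have "Inl ` (?D - {f}) \<union> inner X T \<subseteq> inner X (T \<union> vertices_of C)"
      using C(2) by (auto simp: within_def)
    then have "card (Inl ` (?D - {f}) \<union> inner X T) \<le> card (inner X (T \<union> vertices_of C))"
      using finX by (intro card_mono) (auto simp: within_def)
    moreover have "Inl ` (?D - {f}) \<inter> inner X T = {}" by (auto simp: within_def)
    then have "card (Inl ` (?D - {f}) \<union> inner X T) = card (?D - {f}) + card T"
      using finX circuit_finite[OF C(1)] T(2)
      by (subst card_Un_disjoint) (auto simp: within_def card_image)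
    moreover have "f \<in> ?D" using C(3) f(2) by blast
    then have "card (?D - {f}) = card ?D - 1" by (rule card_Diff_singleton)
    moreover have "T \<union> vertices_of C = T \<union> ?A" by auto
    then have "card (T \<union> vertices_of C) = card T + card ?A"
      using finT finV by (metis Diff_disjoint card_Un_disjoint finite_Diff)
    ultimately have "card (T \<union> vertices_of C) \<le> card (inner X (T \<union> vertices_of C))"
      using AD by linarith
    then have "T \<union> vertices_of C \<subseteq> T" using T(1) VC by (intro maxT) auto
    then show False using C(3) f(2) by blast
  qed
  have "C - {f} \<subseteq> {x. Inl x \<in> X \<and> \<not> ends G x \<subseteq> T}"
  proof
    fix x assume x: "x \<in> C - {f}"
    then have "Inl x \<in> X" using C(2) by auto
    moreover have "ends G x \<noteq> {}" using proper_ends_nonempty[OF pC] x by auto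
    then have "\<not> ends G x \<subseteq> T" using disj x by blast
    ultimately show "x \<in> {x. Inl x \<in> X \<and> \<not> ends G x \<subseteq> T}" by simp
  qed
  then show ?thesis using circuit_in_cl[OF C(1,3)] cl_mono by blast
qed

text \<open>Let \<open>T\<close> be the largest tight set of \<open>X\<close>. If nothing of
  \<open>Y\<close> can be added, the old elements of \<open>Y\<close> outside \<open>T\<close> are
  spanned by those of \<open>X\<close> outside \<open>T\<close>, and the new elements of
  \<open>Y\<close> outside \<open>T\<close> already belong to \<open>X\<close>. Inside
  \<open>T\<close>, the set \<open>Y\<close> has at most \<open>card T\<close> elements, as many as
  \<open>X\<close> has. So \<open>Y\<close> is not larger than \<open>X\<close>.\<close>

lemma ext_augment:
  assumes X: "X \<in> indeps ext" and Y: "Y \<in> indeps ext" and less: "card X < card Y"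
  shows "\<exists>y\<in>Y - X. insert y X \<in> indeps ext"
proof (rule ccontr)
  assume stuck: "\<not> (\<exists>y\<in>Y - X. insert y X \<in> indeps ext)"
  from maximal_tight_set[OF X] obtain T where T: "T \<subseteq> verts G" "card (inner X T) = card T"
    and maxT: "\<And>B. B \<subseteq> verts G \<Longrightarrow> card B \<le> card (inner X B) \<Longrightarrow> B \<subseteq> T" by metis
  have fin: "finite X" "finite Y" using X Y finite_ext_indep by auto
  let ?X2 = "{x. Inl x \<in> X \<and> \<not> ends G x \<subseteq> T}"
  let ?F = "{f. Inl f \<in> Y \<and> \<not> ends G f \<subseteq> T}"
  let ?N = "{n. Inr n \<in> X \<and> h n \<notin> T}"
  have X2: "?X2 \<in> indeps M" using X by (auto simp: ext_indep_iff intro: indep_subset)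
  have F: "?F \<in> indeps M" using Y by (auto simp: ext_indep_iff intro: indep_subset)
  have "?F \<subseteq> cl M ?X2"
  proof
    fix f assume f: "f \<in> ?F"
    then have fg: "f \<in> ground M" using indeps_subset_ground[OF F] by blast
    show "f \<in> cl M ?X2"
    proof (cases "Inl f \<in> X")
      case True
      then show ?thesis using f subset_cl[OF indeps_subset_ground[OF X2]] by blast
    next
      case False
      then have "insert (Inl f) X \<notin> indeps ext" using stuck f by blast
      then show ?thesis using blocked_in_closure[OF X T maxT fg] f False by blast
    qed
  qed
  then have "rank M (?X2 \<union> ?F) = rank M ?X2" by (rule rank_Un_cl[OF finite_indep[OF F]])
  then have FX2: "card ?F \<le> card ?X2"
    using rank_mono[of ?F "?X2 \<union> ?F"] rank_indep[OF F] rank_indep[OF X2] by simp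
  have finN: "finite ?N" using fin(1) finite_vimageI[of X Inr] by (auto intro: finite_subset[rotated])
  have out_Y: "Y - inner Y T \<subseteq> Inl ` ?F \<union> Inr ` ?N"
  proof
    fix y assume y: "y \<in> Y - inner Y T"
    show "y \<in> Inl ` ?F \<union> Inr ` ?N"
    proof (cases y)
      case (Inl f) then show ?thesis using y by (auto simp: within_def)
    next
      case (Inr n)
      then have nT: "h n \<notin> T" using y by (auto simp: within_def)
      \<comment> \<open>A new loop-edge at a vertex outside \<open>T\<close> lies inside no tight
        set and leaves the part in \<open>M\<close> unchanged, so it could be added.\<close>
      have "y \<in> X"
      proof (rule ccontr)
        assume "y \<notin> X"
        then have no: "insert y X \<notin> indeps ext" using stuck y by blast
        have "card (inner (insert y X) B) \<le> card B" if B: "B \<subseteq> verts G" for B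
        proof (cases "h n \<in> B")
          case True
          then have "\<not> card B \<le> card (inner X B)" using maxT[OF B] nT by blast
          moreover have "inner (insert y X) B = insert y (inner X B)"
            using True Inr by (auto simp: within_def)
          ultimately show ?thesis using fin \<open>y \<notin> X\<close> by (simp add: within_def)
        next
          case False
          then have "inner (insert y X) B = inner X B" using Inr by (auto simp: within_def)
          then show ?thesis using X B by (simp add: ext_indep_iff)
        qed
        moreover have "Inl -` insert y X = Inl -` X" using Inr by auto
        moreover have "y \<in> ground ext" using Y y by (auto simp: ext_indep_iff)
        ultimately show False using no X by (simp add: ext_indep_iff)
      qed
      then show ?thesis using Inr nT by auto
    qed
  qed
  have "card (Y - inner Y T) \<le> card (Inl ` ?F \<union> Inr ` ?N)"
    using out_Y finN finite_indep[OF F] by (intro card_mono) auto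
  also have "\<dots> \<le> card ?F + card ?N"
    using card_Un_le[of "Inl ` ?F" "Inr ` ?N"] by (simp add: card_image)
  also have "\<dots> \<le> card ?X2 + card ?N" using FX2 by simp
  also have "\<dots> = card (Inl ` ?X2 \<union> Inr ` ?N)"
    using finN finite_indep[OF X2] by (subst card_Un_disjoint) (auto simp: card_image)
  also have "\<dots> \<le> card (X - inner X T)"
    using fin by (intro card_mono) (auto simp: within_def)
  finally have "card (Y - inner Y T) \<le> card (X - inner X T)" .
  moreover have "card (Z - inner Z T) + card (inner Z T) = card Z" if "finite Z" for Z
    using that by (metis (no_types, lifting) card_Diff_subset card_mono finite_subset le_add_diff_inverse2
        mem_Collect_eq subsetI within_def)
  then have "card (Y - inner Y T) + card (inner Y T) = card Y"
    "card (X - inner X T) + card (inner X T) = card X" using fin by auto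
  moreover have "card (inner Y T) \<le> card T" using Y T by (simp add: ext_indep_iff)
  ultimately show False using less T(2) by linarith
qed

lemma matroid_ext: "matroid ext"
proof
  show "{} \<in> indeps ext" using empty_indep by (simp add: ext_indep_iff within_def)
  show "finite (ground ext)" by (rule finite_ext_ground)
  show "X \<subseteq> ground ext" if "X \<in> indeps ext" for X using that by (simp add: ext_indep_iff)
qed (rule ext_indep_subset ext_augment; assumption)+

section \<open>The new loop-edges form a basis that frames the old elements\<close>

lemma card_joints: "B \<subseteq> verts G \<Longrightarrow> card {n \<in> N. h n \<in> B} = card B"
proof -
  assume "B \<subseteq> verts G"
  then have "h ` {n \<in> N. h n \<in> B} = B" using bij_betw_imp_surj_on[OF h] by auto
  moreover have "inj_on h {n \<in> N. h n \<in> B}"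
    using bij_betw_imp_inj_on[OF h] by (auto intro: inj_on_subset)
  ultimately show ?thesis by (metis card_image)
qed

lemma joints_indep: "Inr ` N \<in> indeps ext"
proof -
  have "inner (Inr ` N) B = Inr ` {n \<in> N. h n \<in> B}" for B by (auto simp: within_def)
  moreover have "Inl -` (Inr ` N :: ('e + nat) set) = {}" by auto
  ultimately show ?thesis
    using card_joints empty_indep by (simp add: ext_indep_iff card_image frame_extension_def)
qed

text \<open>The new loop-edges at the ends of \<open>f\<close> already fill \<open>ends G f\<close>,
  so \<open>f\<close> is one element too many there.\<close>

lemma joints_span:
  assumes "f \<in> ground M" "Inl f \<in> J" "Inr ` {n \<in> N. h n \<in> ends G f} \<subseteq> J"
  shows "J \<notin> indeps ext"
proof
  assume J: "J \<in> indeps ext"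
  have V: "ends G f \<subseteq> verts G" using assms(1) ends_subset_verts by (simp add: ground_eq)
  let ?S = "Inr ` {n \<in> N. h n \<in> ends G f} :: ('e + nat) set"
  have "card (insert (Inl f) ?S) = card (ends G f) + 1"
    using finite_N card_joints[OF V] by (subst card_insert_disjoint) (auto simp: card_image)
  moreover have "card (insert (Inl f) ?S) \<le> card (inner J (ends G f))"
    using assms finite_ext_indep[OF J] by (intro card_mono) (auto simp: within_def)
  moreover have "card (inner J (ends G f)) \<le> card (ends G f)"
    using J V by (simp add: ext_indep_iff)
  ultimately show False by linarith
qed

lemma framed_ext: "framed_matroid ext (Inr ` N)"
  unfolding framed_matroid_def
proof (intro conjI ballI)
  interpret ext: matroid ext by (rule matroid_ext)
  show "matroid ext" by (rule matroid_ext)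
  show "basis ext (Inr ` N)"
    unfolding basis_of_def
  proof (intro conjI ballI impI)
    show "Inr ` N \<in> indeps ext" by (rule joints_indep)
    show "Inr ` N \<subseteq> ground ext" by (auto simp: frame_extension_def)
    fix B assume B: "B \<in> indeps ext" and sub: "Inr ` N \<subseteq> B \<and> B \<subseteq> ground ext"
    have "Inl f \<notin> B" if "f \<in> ground M" for f
      using joints_span[OF that, of B] B sub by auto
    then show "B = Inr ` N" using sub by (auto simp: frame_extension_def)
  qed
  fix y assume y: "y \<in> ground ext"
  show "\<exists>S\<subseteq>Inr ` N. card S \<le> 2 \<and> y \<in> cl ext S"
  proof (cases "y \<in> Inr ` N")
    case True
    then show ?thesis using ext.subset_cl[of "{y}"] y by (intro exI[of _ "{y}"]) auto
  next
    case False
    then obtain f where f: "y = Inl f" "f \<in> ground M" using y by (auto simp: frame_extension_def)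
    let ?S = "Inr ` {n \<in> N. h n \<in> ends G f} :: ('e + nat) set"
    have V: "ends G f \<subseteq> verts G" using f(2) ends_subset_verts by (simp add: ground_eq)
    have "card ?S = card (ends G f)" using card_joints[OF V] by (simp add: card_image)
    moreover have "card (ends G f) \<le> 2" using card_ends[of f] f(2) by (auto simp: ground_eq)
    moreover have "?S \<in> indeps ext" by (rule ext_indep_subset[OF joints_indep]) auto
    then have "y \<in> cl ext ?S"
      using ext.in_cl_iff_dependent[of ?S y] joints_span[OF f(2), of "insert y ?S"] y f(1) by auto
    ultimately show ?thesis by (intro exI[of _ ?S]) auto
  qed
qed

text \<open>For sets of old elements, independence in \<open>M\<close> implies the bicircular
  bounds, because \<open>rank_inside_le\<close> limits the rank inside every vertex set.\<close>

lemma delete_joints: "delete ext (Inr ` N) = relabel Inl M"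
proof -
  have "Inl ` X \<in> indeps ext" if X: "X \<in> indeps M" for X
  proof -
    have "card (inner (Inl ` X) B) \<le> card B" if B: "B \<subseteq> verts G" for B
    proof -
      have eq: "inner (Inl ` X) B = Inl ` within (ends G) X B" by (auto simp: within_def)
      have "within (ends G) X B \<in> indeps M" by (rule indep_subset[OF X]) (auto simp: within_def)
      then have "card (within (ends G) X B) \<le> rank M (inside B)"
        using indeps_subset_ground[OF X] by (intro card_le_rank) (auto simp: within_def ground_eq)
      then show ?thesis using rank_inside_le[OF B] unfolding eq by (simp add: card_image)
    qed
    moreover have "Inl -` (Inl ` X :: ('e + nat) set) = X" by auto
    ultimately show ?thesis
      using X indeps_subset_ground[OF X] by (auto simp: ext_indep_iff frame_extension_def)
  qed
  moreover have "X \<in> (`) Inl ` indeps M" if X: "X \<in> indeps ext" "X \<inter> Inr ` N = {}" for X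
  proof -
    have "X \<subseteq> Inl ` ground M \<union> Inr ` N" using X(1) by (simp add: ext_indep_iff frame_extension_def)
    then have "X \<subseteq> range Inl" using X(2) by blast
    then have "X = Inl ` (Inl -` X)" by (simp add: image_vimage_eq Int_absorb2)
    moreover have "Inl -` X \<in> indeps M" using X(1) by (simp add: ext_indep_iff)
    ultimately show ?thesis by (rule image_eqI)
  qed
  ultimately have "{X \<in> indeps ext. X \<inter> Inr ` N = {}} = (`) Inl ` indeps M" by blast
  moreover have "ground ext - Inr ` N = Inl ` ground M" by (auto simp: frame_extension_def)
  ultimately show ?thesis by (simp add: delete_def relabel_def)
qed

end

lemma frame_matroidI:
  assumes "\<And>C. circuit M C \<Longrightarrow> linked (ends G) C (vertices_of C)"
  shows "frame_matroid M"
proof -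
  obtain h where h: "bij_betw h {0..<card (verts G)} (verts G)"
    using ex_bij_betw_nat_finite[OF finite_verts] by auto
  show ?thesis unfolding frame_matroid_def
    using framed_ext[OF h assms] delete_joints[OF h assms] by metis
qed

end

section \<open>Frameworks with a loop-edge spanned by all cycles\<close>

context framework_graph
begin

text \<open>The leafless count covers all vertices but \<open>v\<close>. If \<open>v\<close> is
  still covered, an edge \<open>f\<close> at \<open>v\<close> supplies the missing one: it is either
  a loop-edge, not counted so far, or it crosses, which makes the count strict.\<close>

lemma circuit_minus_loop:
  assumes C: "circuit M C" and e: "ends G e = {v}"
  shows "card (vertices_of (C - {e})) \<le> card (C - {e})"
proof -
  let ?D = "C - {e}"
  let ?A = "vertices_of ?D - {v}"
  have CE: "C \<subseteq> edges G" by (rule circuit_edges[OF C])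
  have pC: "proper_ends (ends G) C" by (rule proper_subset[OF CE])
  have finC: "finite C" by (rule circuit_finite[OF C])
  have finV: "finite (vertices_of ?D)" using CE by (intro finite_vertices_of) auto
  let ?I = "{f \<in> C. ends G f \<inter> ?A \<noteq> {}}"
  have ID: "?I \<subseteq> ?D" using e by auto
  have AV: "?A \<subseteq> vertices_of C" by auto
  have le: "card ?A \<le> card ?I"
    by (rule leafless_count[OF pC finC circuit_leafless[OF C] AV])
  show ?thesis
  proof (cases "v \<in> vertices_of ?D")
    case False
    then have "?A = vertices_of ?D" by auto
    moreover have "card ?I \<le> card ?D" using ID finC by (intro card_mono) auto
    ultimately show ?thesis using le by simp
  next
    case True
    then have card_A: "card (vertices_of ?D) = Suc (card ?A)" using finV by (metis card_Suc_Diff1)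
    obtain f where f: "f \<in> ?D" "v \<in> ends G f" using True by blast
    have "card ?A < card ?D"
    proof (cases "ends G f \<inter> ?A = {}")
      case True
      then have "?I \<subset> ?D" using ID f by blast
      then have "card ?I < card ?D" using finC by (intro psubset_card_mono) auto
      then show ?thesis using le by simp
    next
      case False
      have "card ?A < card ?I"
        by (rule leafless_crossing_count[OF pC finC circuit_leafless[OF C] AV _ False]) (use f in auto)
      also have "\<dots> \<le> card ?D" using ID finC by (intro card_mono) auto
      finally show ?thesis .
    qed
    then show ?thesis using card_A by simp
  qed
qed

text \<open>The heart of the lifted-graphic case: \<open>Y\<close> is independent after contracting
  an element parallel to \<open>e\<close> iff \<open>Y\<close> is a forest. A dense subset would
  span \<open>e\<close>; conversely, a circuit in \<open>insert e Y\<close> leaves a dense set when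
  \<open>e\<close> is removed.\<close>

lemma indep_with_loop_iff:
  assumes e: "e \<in> edges G" "ends G e = {v}" "{e} \<in> indeps M"
    and spanned: "\<And>D. D \<in> indeps M \<Longrightarrow> D \<noteq> {} \<Longrightarrow> e \<notin> D \<Longrightarrow> card (vertices_of D) \<le> card D \<Longrightarrow> e \<in> cl M D"
    and Y: "Y \<subseteq> edges G"
  shows "e \<notin> Y \<and> insert e Y \<in> indeps M \<longleftrightarrow>
    \<not> (\<exists>D. D \<subseteq> Y \<and> D \<noteq> {} \<and> card (vertices_of D) \<le> card D)"
proof
  assume Ye: "e \<notin> Y \<and> insert e Y \<in> indeps M"
  show "\<not> (\<exists>D. D \<subseteq> Y \<and> D \<noteq> {} \<and> card (vertices_of D) \<le> card D)"
  proof
    assume "\<exists>D. D \<subseteq> Y \<and> D \<noteq> {} \<and> card (vertices_of D) \<le> card D"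
    then obtain D where D: "D \<subseteq> Y" "D \<noteq> {}" "card (vertices_of D) \<le> card D" by blast
    have D': "D \<in> indeps M" "insert e D \<in> indeps M"
      using Ye D(1) by (auto intro: indep_subset[of "insert e Y"])
    have "e \<notin> D" using D(1) Ye by auto
    then show False
      using spanned[OF D'(1) D(2) _ D(3)] in_cl_iff_dependent[OF D'(1), of e] D'(2) e(1)
      by (simp add: ground_eq)
  qed
next
  assume acyclic: "\<not> (\<exists>D. D \<subseteq> Y \<and> D \<noteq> {} \<and> card (vertices_of D) \<le> card D)"
  show "e \<notin> Y \<and> insert e Y \<in> indeps M"
  proof
    show "e \<notin> Y"
    proof
      assume "e \<in> Y"
      then have "{e} \<subseteq> Y \<and> {e} \<noteq> {} \<and> card (vertices_of {e}) \<le> card {e}" using e(2) by simp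
      then show False using acyclic by blast
    qed
    show "insert e Y \<in> indeps M"
    proof (rule ccontr)
      assume "insert e Y \<notin> indeps M"
      then obtain C where C: "circuit M C" "C \<subseteq> insert e Y"
        using dependent_imp_circuit[of "insert e Y"] e(1) Y by (auto simp: ground_eq)
      have "C - {e} \<subseteq> Y" using C(2) by auto
      moreover have "C - {e} \<noteq> {}"
        using C(1) e(3) indep_subset[OF e(3), of C] by (auto simp: circuit_def)
      ultimately show False using acyclic circuit_minus_loop[OF C(1) e(2)] by blast
    qed
  qed
qed

text \<open>The element \<open>Inr 0\<close> is added in parallel to \<open>e\<close>; contracting it leaves the cycle matroid of \<open>G\<close>.\<close>

lemma lifted_graphicI:
  assumes e: "e \<in> edges G" "ends G e = {v}" "{e} \<in> indeps M"
    and spanned: "\<And>D. D \<in> indeps M \<Longrightarrow> D \<noteq> {} \<Longrightarrow> e \<notin> D \<Longrightarrow> card (vertices_of D) \<le> card D \<Longrightarrow> e \<in> cl M D"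
  shows "lifted_graphic M"
proof -
  \<comment> \<open>Pulling \<open>M\<close> back along \<open>q\<close> makes the new element
    \<open>Inr 0\<close> parallel to \<open>e\<close>.\<close>
  define q :: "'e + nat \<Rightarrow> 'e" where "q = case_sum id (\<lambda>_. e)"
  have q: "q (Inl x) = x" "q (Inr n) = e" for x n by (simp_all add: q_def)
  let ?p = "Inr 0 :: 'e + nat"
  let ?A = "insert ?p (Inl ` ground M)"
  define L where "L = \<lparr>ground = ?A, indeps = {J. J \<subseteq> ?A \<and> inj_on q J \<and> q ` J \<in> indeps M}\<rparr>"
  have matL: "matroid L" unfolding L_def
    using finite_ground e(1) by (intro matroid_pullback) (auto simp: q ground_eq)
  have q_Inl: "q ` Inl ` Y = Y" "inj_on q (Inl ` Y)" for Y by (auto simp: q image_image inj_on_def)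
  have indep_L: "Inl ` Y \<in> indeps L \<longleftrightarrow> Y \<in> indeps M" for Y
    using indeps_subset_ground[of Y] by (auto simp: L_def q_Inl)
  have del: "delete L {?p} = relabel Inl M"
  proof -
    have "{X \<in> indeps L. X \<inter> {?p} = {}} = (`) Inl ` indeps M"
    proof (intro equalityI subsetI)
      fix X assume X: "X \<in> {X \<in> indeps L. X \<inter> {?p} = {}}"
      then have "X \<subseteq> Inl ` ground M" by (auto simp: L_def)
      then obtain Y where "X = Inl ` Y" by (auto simp: subset_image_iff)
      then show "X \<in> (`) Inl ` indeps M" using X indep_L by auto
    qed (use indep_L in auto)
    moreover have "ground L - {?p} = Inl ` ground M" by (auto simp: L_def)
    ultimately show ?thesis by (simp add: delete_def relabel_def)
  qed
  obtain g :: "'v \<Rightarrow> nat" where g: "inj_on g (verts G)"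
    using ex_bij_betw_finite_nat[OF finite_verts] bij_betw_imp_inj_on by blast
  \<comment> \<open>A copy of \<open>G\<close> on natural numbers, as \<open>graphic\<close> asks
    for. The loop-edge \<open>e\<close> is kept: it becomes a matroid loop when its parallel element
    is contracted.\<close>
  define K :: "(nat, 'e + nat) pre_graph" where
    "K = \<lparr>verts = g ` verts G, edges = Inl ` edges G, ends = (\<lambda>y. g ` ends G (q y))\<rparr>"
  have card_g: "card (g ` B) = card B" if "B \<subseteq> verts G" for B
    using g that by (intro card_image inj_on_subset[OF g])
  interpret K: graph K
  proof
    show "finite (verts K)" "finite (edges K)" using finite_verts finite_edges by (simp_all add: K_def)
    fix y assume "y \<in> edges K"
    then obtain x where x: "x \<in> edges G" "y = Inl x" by (auto simp: K_def)
    then have "ends K y = g ` ends G x" by (simp add: K_def q)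
    then show "ends K y \<subseteq> verts K" "card (ends K y) = 1 \<or> card (ends K y) = 2"
      using ends_subset_verts[OF x(1)] card_ends[OF x(1)] card_g[of "ends G x"] by (auto simp: K_def)
  qed
  have vertices_K: "\<Union>(ends K ` Inl ` D) = g ` vertices_of D" for D
    by (auto simp: K_def q)
  have contract_indep: "insert ?p (Inl ` Y) \<in> indeps L \<longleftrightarrow> e \<notin> Y \<and> insert e Y \<in> indeps M" for Y
  proof -
    have "q ` insert ?p (Inl ` Y) = insert e Y" by (simp add: q q_Inl)
    moreover have "Inl ` Y - {?p} = Inl ` Y" by auto
    then have "inj_on q (insert ?p (Inl ` Y)) \<longleftrightarrow> e \<notin> Y"
      by (simp add: inj_on_insert q q_Inl)
    ultimately show ?thesis
      using indeps_subset_ground[of "insert e Y"] by (auto simp: L_def)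
  qed
  have graph_indep: "(\<forall>C. cycle K C \<longrightarrow> \<not> C \<subseteq> Inl ` Y) \<longleftrightarrow> e \<notin> Y \<and> insert e Y \<in> indeps M"
    if Y: "Y \<subseteq> edges G" for Y
  proof -
    have "(\<exists>C. cycle K C \<and> C \<subseteq> Inl ` Y) \<longleftrightarrow>
        (\<exists>D. D \<subseteq> Inl ` Y \<and> D \<noteq> {} \<and> card (\<Union>(ends K ` D)) \<le> card D)"
      using Y by (intro K.contains_cycle_iff) (auto simp: K_def)
    also have "\<dots> \<longleftrightarrow> (\<exists>D. D \<subseteq> Y \<and> D \<noteq> {} \<and> card (\<Union>(ends K ` Inl ` D)) \<le> card (Inl ` D :: ('e + nat) set))"
    proof (intro iffI; elim exE conjE)
      fix D assume "D \<subseteq> Inl ` Y" and D: "D \<noteq> {}" "card (\<Union>(ends K ` D)) \<le> card D"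
      then obtain D' where "D' \<subseteq> Y" "D = Inl ` D'" by (auto simp: subset_image_iff)
      then show "\<exists>D. D \<subseteq> Y \<and> D \<noteq> {} \<and> card (\<Union>(ends K ` Inl ` D)) \<le> card (Inl ` D :: ('e + nat) set)"
        using D by (intro exI[of _ D']) simp
    next
      fix D assume "D \<subseteq> Y" "D \<noteq> {}" "card (\<Union>(ends K ` Inl ` D)) \<le> card (Inl ` D :: ('e + nat) set)"
      then show "\<exists>D. D \<subseteq> Inl ` Y \<and> D \<noteq> {} \<and> card (\<Union>(ends K ` D)) \<le> card D"
        by (intro exI[of _ "Inl ` D"]) auto
    qed
    also have "\<dots> \<longleftrightarrow> (\<exists>D. D \<subseteq> Y \<and> D \<noteq> {} \<and> card (vertices_of D) \<le> card D)"
    proof (rule ex_cong1, rule conj_cong[OF refl], rule conj_cong[OF refl])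
      fix D assume "D \<subseteq> Y"
      then have "card (\<Union>(ends K ` Inl ` D)) = card (vertices_of D)"
        unfolding vertices_K using Y by (intro card_g vertices_of_subset) auto
      then show "card (\<Union>(ends K ` Inl ` D)) \<le> card (Inl ` D :: ('e + nat) set) \<longleftrightarrow>
          card (vertices_of D) \<le> card D"
        by (simp only: card_image[OF inj_Inl])
    qed
    finally show ?thesis using indep_with_loop_iff[OF e spanned Y] by blast
  qed
  have basis_p: "basis_of L {?p} B \<longleftrightarrow> B = {?p}" for B
  proof -
    have "{?p} \<in> indeps L" using e(1,3) by (simp add: L_def q)
    then show ?thesis unfolding basis_of_def by blast
  qed
  have "contract L {?p} = cycle_matroid K"
  proof -
    have gr: "ground L - {?p} = Inl ` edges G" by (auto simp: L_def ground_eq)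
    have "{X. X \<subseteq> Inl ` edges G \<and> X \<union> {?p} \<in> indeps L} =
        {X. X \<subseteq> Inl ` edges G \<and> (\<forall>C. cycle K C \<longrightarrow> \<not> C \<subseteq> X)}"
    proof (rule Collect_cong, rule conj_cong[OF refl])
      fix X :: "('e + nat) set" assume "X \<subseteq> Inl ` edges G"
      then obtain Y where Y: "Y \<subseteq> edges G" "X = Inl ` Y" by (auto simp: subset_image_iff)
      show "X \<union> {?p} \<in> indeps L \<longleftrightarrow> (\<forall>C. cycle K C \<longrightarrow> \<not> C \<subseteq> X)"
        unfolding Y(2) graph_indep[OF Y(1)] using contract_indep[of Y] by simp
    qed
    then show ?thesis
      unfolding contract_def cycle_matroid_def gr basis_p by (simp add: K_def)
  qed
  then have "graphic (contract L {?p})" unfolding graphic_def using K.graph_axioms by blast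
  then show ?thesis unfolding lifted_graphic_def
    using matL del by (intro exI[of _ L] exI[of _ ?p]) (simp add: L_def)
qed

end

section \<open>Components of the graph without the vertex of the loop-edge\<close>

locale framework_with_loop = framework_graph M G
  for M :: "'e pre_matroid" and G :: "('v, 'e) pre_graph" +
  fixes e :: 'e and v :: 'v
  assumes e_edge: "e \<in> edges G" and e_loop: "ends G e = {v}"
begin

lemma v_vertex: "v \<in> verts G"
  using ends_subset_verts[OF e_edge] e_loop by simp

definition comp_avoiding_v :: "'v \<Rightarrow> 'v set" where
  "comp_avoiding_v a = reach (ends G) {f \<in> edges G. v \<notin> ends G f} a"

definition incident :: "'v set \<Rightarrow> 'e set" where
  "incident A = {f \<in> edges G. ends G f \<inter> A \<noteq> {}}"

lemma comp_avoiding_v: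
  assumes "a \<in> verts G" "a \<noteq> v"
  shows "v \<notin> comp_avoiding_v a" "a \<in> comp_avoiding_v a" "comp_avoiding_v a \<subseteq> verts G"
    and "linked (ends G) (edges G) (comp_avoiding_v a)"
    and "f \<in> edges G \<Longrightarrow> ends G f \<inter> comp_avoiding_v a \<noteq> {} \<Longrightarrow>
      ends G f \<subseteq> insert v (comp_avoiding_v a)"
proof -
  let ?F = "{f \<in> edges G. v \<notin> ends G f}"
  have pF: "proper_ends (ends G) ?F" by (rule proper_subset) auto
  have "comp_avoiding_v a \<subseteq> - {v}"
    unfolding comp_avoiding_v_def by (rule reach_least) (use assms(2) in auto)
  then show "v \<notin> comp_avoiding_v a" by auto
  show "a \<in> comp_avoiding_v a" unfolding comp_avoiding_v_def by (rule reach_refl)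
  show "comp_avoiding_v a \<subseteq> verts G"
    unfolding comp_avoiding_v_def
    by (rule reach_least) (use assms(1) ends_subset_verts in auto)
  show "linked (ends G) (edges G) (comp_avoiding_v a)"
    unfolding comp_avoiding_v_def by (rule linked_mono[OF linked_reach[OF pF]]) auto
  assume f: "f \<in> edges G" "ends G f \<inter> comp_avoiding_v a \<noteq> {}"
  show "ends G f \<subseteq> insert v (comp_avoiding_v a)"
  proof (cases "v \<in> ends G f")
    case True
    obtain x y where "ends G f = {x, y}" by (rule proper_endsE[OF proper f(1)])
    then show ?thesis using True f(2) \<open>v \<notin> comp_avoiding_v a\<close> by auto
  next
    case False
    then show ?thesis
      using reach_closed[OF pF, of f a] f unfolding comp_avoiding_v_def by auto
  qed
qed

text \<open>If an edge joins \<open>v\<close> to \<open>A\<close>, growing from \<open>v\<close>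
  raises the rank of the other side by \<open>card A\<close>, while \<open>incident A\<close> has
  rank at most \<open>card A + 1\<close>. If not, growing from \<open>a\<close> gives
  \<open>card A - 1\<close> against \<open>card A\<close>. The slack is 1 in both cases.\<close>

lemma comp_connectivity:
  assumes a: "a \<in> verts G" "a \<noteq> v"
  defines "A \<equiv> comp_avoiding_v a"
  shows "rank M (incident A) + rank M (edges G - incident A) \<le> rank M (edges G) + 1"
proof -
  note A = comp_avoiding_v[OF a, folded A_def]
  have finA: "finite A" by (rule finite_subset[OF A(3) finite_verts])
  let ?X = "edges G - incident A"
  have avoid: "ends G x \<inter> A = {}" if "x \<in> ?X" for x using that by (auto simp: incident_def)
  have sub: "rank M (?X \<union> inside B) \<le> rank M (edges G)" for B
    by (rule rank_mono) (auto simp: within_def)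
  show ?thesis
  proof (cases "\<exists>f \<in> edges G. v \<in> ends G f \<and> ends G f \<inter> A \<noteq> {}")
    case True
    then obtain f where f: "f \<in> edges G" "v \<in> ends G f" "ends G f \<inter> A \<noteq> {}" by blast
    have linked: "linked (ends G) (edges G) (insert v A)"
      by (rule linked_insert[OF A(4,1) f A(5)[OF f(1,3)]])
    have "rank M ?X + card (insert v A - {v}) \<le> rank M (?X \<union> inside (insert v A))"
      by (rule rank_growth[OF linked]) (use finA avoid in auto)
    moreover have "card (insert v A - {v}) = card A" using A(1) by simp
    moreover have "incident A \<subseteq> inside (insert v A)"
      using A(5) by (auto simp: incident_def within_def)
    then have "rank M (incident A) \<le> rank M (inside (insert v A))" by (rule rank_mono)
    moreover have "rank M (inside (insert v A)) \<le> card (insert v A)"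
      using A(3) v_vertex by (intro rank_inside_le) auto
    moreover have "card (insert v A) = card A + 1" using A(1) finA by simp
    ultimately show ?thesis using sub[of "insert v A"] by linarith
  next
    case False
    have "rank M ?X + card (A - {a}) \<le> rank M (?X \<union> inside A)"
      by (rule rank_growth[OF A(4) finA]) (use A(2) avoid in auto)
    moreover have "card A = card (A - {a}) + 1" using A(2) finA by (metis Suc_eq_plus1 card_Suc_Diff1)
    moreover have "incident A \<subseteq> inside A"
      using A(5) False unfolding incident_def within_def by blast
    then have "rank M (incident A) \<le> rank M (inside A)" by (rule rank_mono)
    moreover have "rank M (inside A) \<le> card A" by (rule rank_inside_le[OF A(3)])
    ultimately show ?thesis using sub[of A] by linarith
  qed
qed

text \<open>If \<open>D\<close> covers \<open>v\<close>, adding \<open>e\<close> brings no new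
  vertex, so the rank cannot rise above \<open>card D\<close>. Otherwise \<open>D\<close> lies
  inside \<open>A\<close>; if it did not span \<open>e\<close>, growing \<open>insert e D\<close>
  through \<open>A\<close> would give rank above \<open>card A\<close>, although
  \<open>inside A\<close> spans \<open>e\<close>.\<close>

lemma lifted_graphic_if_spanned:
  assumes a: "a \<in> verts G" "a \<noteq> v"
  defines "A \<equiv> comp_avoiding_v a"
  assumes indep: "{e} \<in> indeps M" and all: "edges G \<subseteq> insert e (incident A)" and span: "e \<in> cl M (inside A)"
  shows "lifted_graphic M"
proof (rule lifted_graphicI[OF e_edge e_loop indep])
  note A = comp_avoiding_v[OF a, folded A_def]
  fix D assume D: "D \<in> indeps M" "D \<noteq> {}" "e \<notin> D" "card (vertices_of D) \<le> card D"
  have DE: "D \<subseteq> edges G" using indeps_subset_ground[OF D(1)] by (simp add: ground_eq)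
  have eM: "e \<in> ground M" using e_edge by (simp add: ground_eq)
  show "e \<in> cl M D"
  proof (cases "v \<in> vertices_of D")
    case True
    then have "vertices_of (insert e D) = vertices_of D" using e_loop by auto
    then have "rank M (insert e D) \<le> card D"
      using rank_le_vertices[of "insert e D"] DE e_edge D(4) by simp
    then show ?thesis
      using rank_indep[OF D(1)] rank_insert_notin_cl[OF eM, of D] by linarith
  next
    case False
    have VA: "vertices_of D \<subseteq> A"
    proof
      fix x assume "x \<in> vertices_of D"
      then obtain f where f: "f \<in> D" "x \<in> ends G f" by auto
      then have "f \<in> incident A" using all DE D(3) by blast
      then have "ends G f \<subseteq> insert v A" using A(5)[of f] by (auto simp: incident_def)
      then show "x \<in> A" using f False by blast
    qed
    have finA: "finite A" by (rule finite_subset[OF A(3) finite_verts])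
    have ne: "vertices_of D \<noteq> {}" using D(2) proper_ends_nonempty[OF proper_subset[OF DE]] by blast
    show ?thesis
    proof (rule ccontr)
      assume "e \<notin> cl M D"
      then have "rank M (insert e D) = card D + 1"
        using rank_insert_notin_cl[OF eM] rank_indep[OF D(1)] by simp
      moreover have "rank M (insert e D) + card (A - vertices_of D) \<le> rank M (insert e D \<union> inside A)"
        by (rule rank_growth[OF A(4) finA VA ne]) (use DE e_edge e_loop A(1) in auto)
      moreover have "insert e D \<union> inside A = insert e (inside A)"
        using VA DE by (auto simp: within_def)
      then have "rank M (insert e D \<union> inside A) = rank M (inside A)"
        using span eM by (simp add: mem_cl_iff)
      moreover have "rank M (inside A) \<le> card A" by (rule rank_inside_le[OF A(3)])
      moreover have "card A = card (vertices_of D) + card (A - vertices_of D)"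
        using VA finA by (metis card_Diff_subset card_mono finite_subset le_add_diff_inverse)
      ultimately show False using D(4) by linarith
    qed
  qed
qed

text \<open>If the set \<open>Z\<close> reachable from \<open>v\<close> without touching \<open>C2\<close> contained \<open>C1\<close>, then growing \<open>C2 \<union> {e}\<close> from \<open>v\<close> through
  \<open>Z\<close> would give rank \<open>|C2| + |Z|\<close>, which is too much because \<open>C1 \<union> C2\<close> is dependent.\<close>

lemma circuit_parts_separated:
  assumes C: "circuit M (C1 \<union> C2)" and disj: "vertices_of C1 \<inter> vertices_of C2 = {}"
    and ne: "C1 \<noteq> {}" "C2 \<noteq> {}" and free: "e \<notin> cl M C2"
  shows "vertices_of C1 \<inter> reach (ends G) {f \<in> edges G. ends G f \<inter> vertices_of C2 = {}} v = {}"
proof (rule ccontr)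
  let ?F = "{f \<in> edges G. ends G f \<inter> vertices_of C2 = {}}"
  let ?Z = "reach (ends G) ?F v"
  assume meet: "vertices_of C1 \<inter> ?Z \<noteq> {}"
  have CE: "C1 \<subseteq> edges G" "C2 \<subseteq> edges G" using circuit_edges[OF C] by auto
  have pF: "proper_ends (ends G) ?F" by (rule proper_subset) auto
  have C1C2: "C1 \<inter> C2 = {}"
    using disj proper_ends_nonempty[OF proper_subset[OF CE(1)]] by blast
  have fin: "finite C1" "finite C2" using circuit_finite[OF C] by auto
  have "C1 \<subset> C1 \<union> C2" "C2 \<subset> C1 \<union> C2" using C1C2 ne by blast+
  then have indep: "C1 \<in> indeps M" "C2 \<in> indeps M" using C by (auto simp: circuit_def)
  have vC2: "v \<notin> vertices_of C2"
  \<comment> \<open>If \<open>C2\<close> covered \<open>v\<close>, no edge could leave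
    \<open>v\<close> within \<open>?F\<close>, so \<open>?Z\<close> would be \<open>{v}\<close> and
    \<open>C1\<close> would meet \<open>C2\<close> at \<open>v\<close>.\<close>
  proof
    assume "v \<in> vertices_of C2"
    then have "?F \<subseteq> {f \<in> edges G. v \<notin> ends G f}" by blast
    then have "?Z \<subseteq> {v}" by (intro reach_least) auto
    then have "v \<in> vertices_of C1" using meet by blast
    then show False using disj \<open>v \<in> vertices_of C2\<close> by blast
  qed
  have Zdisj: "?Z \<subseteq> - vertices_of C2" by (rule reach_least) (use vC2 in auto)
  have Zv: "v \<in> ?Z" by (rule reach_refl)
  have ZV: "?Z \<subseteq> verts G" by (rule reach_least) (use v_vertex ends_subset_verts in auto)
  have finZ: "finite ?Z" by (rule finite_subset[OF ZV finite_verts])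
  have linkedZ: "linked (ends G) (edges G) ?Z" by (rule linked_mono[OF linked_reach[OF pF]]) auto
  have "vertices_of C1 \<subseteq> ?Z"
  proof (rule linked_subset_closed[OF circuit_part_linked[OF C disj ne(2)] meet])
    fix f assume f: "f \<in> C1" "ends G f \<inter> ?Z \<noteq> {}"
    then have "f \<in> ?F" using CE(1) disj by auto
    then show "ends G f \<subseteq> ?Z" using f(2) by (rule reach_closed[OF pF])
  qed
  then have C1Z: "C1 \<subseteq> inside ?Z" using CE(1) by (auto simp: within_def)
  have eM: "e \<in> ground M" using e_edge by (simp add: ground_eq)
  have "rank M (insert e C2) = card C2 + 1"
    using rank_insert_notin_cl[OF eM free] rank_indep[OF indep(2)] by simp
  moreover have "rank M (insert e C2) + card (?Z - {v}) \<le> rank M (insert e C2 \<union> inside ?Z)"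
  proof (rule rank_growth[OF linkedZ finZ])
    show "{v} \<subseteq> ?Z" "{v} \<noteq> {}" "insert e C2 \<subseteq> edges G" using Zv CE(2) e_edge by simp_all
    show "ends G x \<inter> (?Z - {v}) = {}" if "x \<in> insert e C2" for x
    proof (cases "x = e")
      case False
      then have "ends G x \<subseteq> vertices_of C2" using that by auto
      then show ?thesis using Zdisj by blast
    qed (simp add: e_loop)
  qed
  moreover have "insert e C2 \<union> inside ?Z = C2 \<union> inside ?Z"
    using e_edge e_loop Zv by (auto simp: within_def)
  then have "rank M (insert e C2 \<union> inside ?Z) = rank M (C2 \<union> inside ?Z)"
    by (rule arg_cong)
  moreover have "card ?Z = card (?Z - {v}) + 1" using card_Suc_Diff1[OF finZ Zv] by linarith
  \<comment> \<open>Submodularity bounds the rank of \<open>C2 \<union> inside ?Z\<close> by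
    \<open>(card C1 + card C2 - 1) + card ?Z - card C1\<close>, one less than the growth
    bound.\<close>
  moreover have "rank M (C1 \<union> C2 \<union> inside ?Z) + rank M ((C1 \<union> C2) \<inter> inside ?Z)
      \<le> rank M (C1 \<union> C2) + rank M (inside ?Z)" by (rule rank_submodular)
  moreover have "rank M (C2 \<union> inside ?Z) \<le> rank M (C1 \<union> C2 \<union> inside ?Z)" by (rule rank_mono) auto
  moreover have "rank M C1 \<le> rank M ((C1 \<union> C2) \<inter> inside ?Z)" using C1Z by (intro rank_mono) auto
  moreover have "rank M C1 = card C1" by (rule rank_indep[OF indep(1)])
  moreover have "rank M (C1 \<union> C2) + 1 = card C1 + card C2"
    using rank_circuit[OF C] card_Un_disjoint[OF fin C1C2] by simp
  moreover have "rank M (inside ?Z) \<le> card ?Z" by (rule rank_inside_le[OF ZV])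
  ultimately show False by linarith
qed

text \<open>A part of a circuit that avoids \<open>v\<close> lies inside \<open>A\<close> and so
  does not span \<open>e\<close>. Given a disconnected circuit, explore from \<open>v\<close> while
  avoiding both parts: the first edge into one part reaches it while avoiding the other, against
  \<open>circuit_parts_separated\<close>.\<close>

lemma frame_matroid_if_not_spanned:
  assumes a: "a \<in> verts G" "a \<noteq> v"
  defines "A \<equiv> comp_avoiding_v a"
  assumes all: "edges G \<subseteq> insert e (incident A)" and coloop: "e \<in> cl M (edges G - {e})"
    and free: "e \<notin> cl M (inside A)"
  shows "frame_matroid M"
proof (rule frame_matroidI, rule ccontr)
  note A = comp_avoiding_v[OF a, folded A_def]
  have ends_A: "ends G f \<subseteq> insert v A" if "f \<in> edges G" for f
    using that all A(5)[of f] e_loop by (auto simp: incident_def)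
  \<comment> \<open>The element \<open>e\<close> is spanned by the other edges but not by those
    inside \<open>A\<close>, so some other edge joins \<open>v\<close> to \<open>A\<close>.\<close>
  have "\<not> edges G - {e} \<subseteq> inside A" using coloop free cl_mono by blast
  then obtain f where f: "f \<in> edges G" "f \<noteq> e" "\<not> ends G f \<subseteq> A" by (auto simp: within_def)
  then have "ends G f \<inter> A \<noteq> {}" using all by (auto simp: incident_def)
  moreover have "v \<in> ends G f" using ends_A[OF f(1)] f(3) by blast
  ultimately have linked: "linked (ends G) (edges G) (insert v A)"
    using linked_insert[OF A(4,1) f(1)] ends_A[OF f(1)] by simp
  fix C assume C: "circuit M C" and "\<not> linked (ends G) C (vertices_of C)"
  then obtain T where T: "T \<subset> vertices_of C" "T \<noteq> {}"
    and "\<not> (\<exists>f\<in>C. ends G f \<subseteq> vertices_of C \<and> ends G f \<inter> T \<noteq> {} \<and> \<not> ends G f \<subseteq> T)"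
    unfolding linked_def by auto
  then have nocross: "ends G f \<subseteq> T" if "f \<in> C" "ends G f \<inter> T \<noteq> {}" for f using that by blast
  define C1 where "C1 = {f \<in> C. ends G f \<subseteq> T}"
  define C2 where "C2 = {f \<in> C. ends G f \<inter> T = {}}"
  have CE: "C \<subseteq> edges G" by (rule circuit_edges[OF C])
  have C12: "C = C1 \<union> C2" using nocross unfolding C1_def C2_def by blast
  have disj: "vertices_of C1 \<inter> vertices_of C2 = {}" unfolding C1_def C2_def by blast
  have ne: "C1 \<noteq> {}" "C2 \<noteq> {}" using T nocross unfolding C1_def C2_def by blast+
  have nb: "circuit M (C1 \<union> C2)" "circuit M (C2 \<union> C1)" using C by (simp_all add: C12 Un_commute)
  have inA: "e \<notin> cl M D" if "D \<subseteq> C" "v \<notin> vertices_of D" for D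
  proof -
    have "ends G f \<subseteq> A" if "f \<in> D" for f
      using ends_A[of f] \<open>D \<subseteq> C\<close> CE \<open>v \<notin> vertices_of D\<close> that by blast
    then have "D \<subseteq> inside A" using \<open>D \<subseteq> C\<close> CE by (auto simp: within_def)
    then show ?thesis using free cl_mono by blast
  qed
  let ?F = "\<lambda>B. {f \<in> edges G. ends G f \<inter> B = {}}"
  let ?Z = "\<lambda>B. reach (ends G) (?F B) v"
  have pF: "proper_ends (ends G) (?F B)" for B by (rule proper_subset) auto
  have Z1: "vertices_of C1 \<inter> ?Z (vertices_of C2) = {}" if "v \<notin> vertices_of C2"
    by (rule circuit_parts_separated[OF nb(1) disj ne inA]) (use that C12 in auto)
  have Z2: "vertices_of C2 \<inter> ?Z (vertices_of C1) = {}" if "v \<notin> vertices_of C1"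
    by (rule circuit_parts_separated[OF nb(2) _ ne(2,1) inA]) (use that C12 disj in auto)
  have vZ: "v \<in> ?Z B" for B by (rule reach_refl)
  \<comment> \<open>If \<open>C1\<close> covered \<open>v\<close>, then \<open>C2\<close> would not,
    so \<open>Z1\<close> would apply, although \<open>v\<close> is reachable from itself.\<close>
  have v1: "v \<notin> vertices_of C1" using Z1 vZ[of "vertices_of C2"] disj by blast
  have v2: "v \<notin> vertices_of C2" using Z2[OF v1] vZ[of "vertices_of C1"] by blast
  let ?R = "?Z (vertices_of C1 \<union> vertices_of C2)"
  have R: "?R \<subseteq> - (vertices_of C1 \<union> vertices_of C2)" by (rule reach_least) (use v1 v2 in auto)
  have RZ: "?R \<subseteq> ?Z B" if "B \<subseteq> vertices_of C1 \<union> vertices_of C2" for B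
    by (rule reach_least[OF vZ]) (rule reach_closed[OF pF], use that in auto)
  have "vertices_of C1 \<subseteq> insert v A" using ends_A CE by (auto simp: C1_def)
  moreover have "vertices_of C1 \<noteq> {}"
    using ne(1) proper_ends_nonempty[OF proper_subset[OF CE]] by (auto simp: C1_def)
  ultimately have "?R \<inter> insert v A \<subset> insert v A" using R by blast
  moreover have "?R \<inter> insert v A \<noteq> {}" using vZ by blast
  ultimately obtain g where "g \<in> edges G" "ends G g \<subseteq> insert v A"
    "ends G g \<inter> (?R \<inter> insert v A) \<noteq> {}" "\<not> ends G g \<subseteq> ?R \<inter> insert v A"
    by (rule linkedE[OF linked])
  then have g: "g \<in> edges G" "ends G g \<inter> ?R \<noteq> {}" "\<not> ends G g \<subseteq> ?R" by blast+
  obtain p q where pq: "ends G g = {p, q}" by (rule proper_endsE[OF proper g(1)])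
  obtain x y where xy: "ends G g = {x, y}" "x \<in> ?R" "y \<notin> ?R"
    using g(2,3) unfolding pq by (cases "p \<in> ?R") (auto simp: insert_commute)
  \<comment> \<open>Otherwise \<open>g\<close> would avoid both parts and \<open>y\<close> would
    belong to \<open>?R\<close>.\<close>
  have "y \<in> vertices_of C1 \<union> vertices_of C2"
  proof (rule ccontr)
    assume "y \<notin> vertices_of C1 \<union> vertices_of C2"
    then have "g \<in> ?F (vertices_of C1 \<union> vertices_of C2)" using g(1) xy R by auto
    then show False using reach_closed[OF pF, of g _ v] g(2,3) by blast
  qed
  then show False
  proof
    assume y: "y \<in> vertices_of C1"
    then have "g \<in> ?F (vertices_of C2)" using g(1) xy R disj by auto
    moreover have "x \<in> ?Z (vertices_of C2)" using RZ xy(2) by blast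
    ultimately have "ends G g \<subseteq> ?Z (vertices_of C2)" using xy(1) by (intro reach_closed[OF pF]) auto
    then show False using y xy(1) Z1[OF v2] by blast
  next
    assume y: "y \<in> vertices_of C2"
    then have "g \<in> ?F (vertices_of C1)" using g(1) xy R disj by auto
    moreover have "x \<in> ?Z (vertices_of C1)" using RZ xy(2) by blast
    ultimately have "ends G g \<subseteq> ?Z (vertices_of C1)" using xy(1) by (intro reach_closed[OF pF]) auto
    then show False using y xy(1) Z2[OF v1] by blast
  qed
qed

text \<open>Loop-edges at one vertex have rank at most 1. A circuit at a single vertex thus has at
  most two elements; otherwise it splits into two independent parts, each linked, hence at a single
  vertex and of size at most 1.\<close>

lemma circuit_of_loops:
  assumes loops: "\<And>f. f \<in> edges G \<Longrightarrow> card (ends G f) = 1" and C: "circuit M C"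
  shows "card C \<le> 2"
proof -
  have CE: "C \<subseteq> edges G" by (rule circuit_edges[OF C])
  have finC: "finite C" by (rule circuit_finite[OF C])
  obtain x where x: "x \<in> C" using circuit_nonempty[OF C] by auto
  have single: "\<exists>w. ends G f = {w}" if "f \<in> C" for f
    using loops[OF subsetD[OF CE that]] by (simp add: card_1_singleton_iff)
  obtain u where u: "ends G x = {u}" using single[OF x] by blast
  define C1 where "C1 = {f \<in> C. ends G f = {u}}"
  define C2 where "C2 = C - C1"
  have C12: "C = C1 \<union> C2" by (auto simp: C1_def C2_def)
  have V1: "vertices_of C1 = {u}" using x u by (auto simp: C1_def)
  have disj: "vertices_of C1 \<inter> vertices_of C2 = {}"
    unfolding V1 using single by (fastforce simp: C2_def C1_def)
  have r1: "rank M C1 \<le> 1" using rank_le_vertices[of C1] CE unfolding V1 by (simp add: C12)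
  show ?thesis
  proof (cases "C2 = {}")
    case True
    then show ?thesis using rank_circuit[OF C] r1 C12 by simp
  next
    case False
    have C': "circuit M (C2 \<union> C1)" using C by (simp add: C12 Un_commute)
    have ne1: "C1 \<noteq> {}" using V1 by auto
    have "C1 \<subset> C" "C2 \<subset> C" using False ne1 by (auto simp: C1_def C2_def)
    then have indep: "C1 \<in> indeps M" "C2 \<in> indeps M" using C by (auto simp: circuit_def)
    have link2: "linked (ends G) C2 (vertices_of C2)"
      by (rule circuit_part_linked[OF C' _ ne1]) (use disj in auto)
    obtain y where y: "y \<in> C2" using False by auto
    obtain w where w: "ends G y = {w}" using single[of y] y C12 by auto
    have "vertices_of C2 = {w}"
    proof (rule ccontr)
      assume "vertices_of C2 \<noteq> {w}"
      then have "{w} \<subset> vertices_of C2" using y w by auto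
      from linkedE[OF link2 this] obtain g where
        g: "g \<in> C2" "ends G g \<inter> {w} \<noteq> {}" "\<not> ends G g \<subseteq> {w}" by blast
      then show False using single[of g] C12 by auto
    qed
    then have "rank M C2 \<le> 1" using rank_le_vertices[of C2] CE by (simp add: C12)
    then have "card C1 \<le> 1" "card C2 \<le> 1" using r1 rank_indep indep by auto
    then show ?thesis using card_Un_le[of C1 C2] by (simp add: C12)
  qed
qed

section \<open>Consequences of 3-connectivity\<close>

context
  assumes conn: "n_connected 3 M" and large: "card (edges G) \<ge> 2"
begin

lemma connectivity_1:
  assumes "X \<subseteq> edges G" "X \<noteq> {}" "edges G - X \<noteq> {}"
  shows "rank M (edges G) + 1 \<le> rank M X + rank M (edges G - X)"
proof -
  have "finite X" "finite (edges G - X)" using assms finite_edges finite_subset by auto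
  then have "1 \<le> card X" "1 \<le> card (edges G - X)" using assms by (simp_all add: Suc_le_eq card_gt_0_iff)
  moreover have "\<not> k_separation 1 M X (edges G - X)"
    using conn unfolding n_connected_def by (metis one_less_numeral_iff order_refl semiring_norm(77))
  ultimately show ?thesis using assms(1) by (auto simp: k_separation_def ground_eq)
qed

lemma connectivity_2:
  assumes "X \<subseteq> edges G" "2 \<le> card X" "2 \<le> card (edges G - X)"
  shows "rank M (edges G) + 2 \<le> rank M X + rank M (edges G - X)"
proof -
  have "\<not> k_separation 2 M X (edges G - X)" using conn by (simp add: n_connected_def)
  then show ?thesis using assms by (auto simp: k_separation_def ground_eq)
qed

lemma rest_nonempty: "f \<in> edges G \<Longrightarrow> edges G - {f} \<noteq> {}"
  using large card_mono[of "{f}" "edges G"] by auto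

lemma no_matroid_loop:
  assumes "f \<in> edges G" shows "{f} \<in> indeps M"
proof (rule indep_rankI)
  have "rank M (edges G - {f}) \<le> rank M (edges G)" by (rule rank_mono) auto
  then show "rank M {f} = card {f}"
    using connectivity_1[of "{f}"] rest_nonempty assms rank_le_card[of "{f}"] by simp
qed simp

lemma no_coloop:
  assumes "f \<in> edges G" shows "f \<in> cl M (edges G - {f})"
proof (rule ccontr)
  assume "f \<notin> cl M (edges G - {f})"
  then have "rank M (edges G) = rank M (edges G - {f}) + 1"
    using rank_insert_notin_cl[of f "edges G - {f}"] assms by (simp add: ground_eq insert_absorb)
  then show False using connectivity_1[of "{f}"] rest_nonempty assms rank_le_card[of "{f}"] by simp
qed

lemma lifted_graphic_if_scattered:
  assumes scattered: "\<And>a. a \<in> verts G \<Longrightarrow> a \<noteq> v \<Longrightarrow> card (incident (comp_avoiding_v a)) \<le> 1"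
  shows "lifted_graphic M"
proof -
  \<comment> \<open>An edge with two ends has an end \<open>a\<close> other than \<open>v\<close>.
    It would be the only edge at \<open>a\<close>, and the closure condition would make it a
    coloop.\<close>
  have loops: "card (ends G f) = 1" if f: "f \<in> edges G" for f
  proof (rule ccontr)
    assume no_loop: "card (ends G f) \<noteq> 1"
    obtain x y where "ends G f = {x, y}" by (rule proper_endsE[OF proper f])
    then obtain a where a: "a \<in> ends G f" "a \<noteq> v" using no_loop by (cases "x = v"; cases "y = v") auto
    have aV: "a \<in> verts G" using a(1) ends_subset_verts[OF f] by auto
    have star: "x = f" if "x \<in> edges G" "a \<in> ends G x" for x
    proof -
      have "{x, f} \<subseteq> incident (comp_avoiding_v a)"
        using that f a comp_avoiding_v(2)[OF aV a(2)] by (auto simp: incident_def)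
      moreover have "finite (incident (comp_avoiding_v a))" using finite_edges by (simp add: incident_def)
      ultimately have "card {x, f} \<le> card (incident (comp_avoiding_v a))" by (rule card_mono[rotated])
      then have "card {x, f} \<le> 1" using scattered[OF aV a(2)] by linarith
      then show ?thesis by (cases "x = f") auto
    qed
    have "ends G f \<noteq> {a}" using no_loop by auto
    moreover have "a \<notin> ends G x" if "x \<in> edges G - {f}" for x using star[of x] that by auto
    ultimately have "f \<notin> cl M (edges G - {f})" by (rule leaf_notin_cl[OF f a(1) _ Diff_subset])
    then show False using no_coloop[OF f] by simp
  qed
  have e: "{e} \<in> indeps M" by (rule no_matroid_loop[OF e_edge])
  define P where "P = cl M {e}"
  have eP: "e \<in> P" using subset_cl[of "{e}"] e_edge by (simp add: P_def ground_eq)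
  have PE: "P \<subseteq> edges G" by (auto simp: P_def cl_def ground_eq)
  \<comment> \<open>\<open>P\<close> is the parallel class of \<open>e\<close>, and circuits have at
    most two elements, so a crossing circuit would make an outside element parallel to
    \<open>e\<close>. Hence \<open>P\<close> is a separator, which forces rank 1; then every
    nonempty independent set spans \<open>e\<close>.\<close>
  have "C \<subseteq> P \<or> C \<subseteq> edges G - P" if C: "circuit M C" for C
  proof (rule ccontr)
    assume "\<not> (C \<subseteq> P \<or> C \<subseteq> edges G - P)"
    then obtain x y where xy: "x \<in> C" "x \<in> P" "y \<in> C" "y \<notin> P" using circuit_edges[OF C] by blast
    then have "x \<noteq> y" by auto
    then have "C = {x, y}"
      using card_seteq[of C "{x, y}"] circuit_of_loops[OF loops C] circuit_finite[OF C] xy by auto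
    then have "y \<in> cl M {x}" using circuit_in_cl[OF C xy(3)] \<open>x \<noteq> y\<close> by (simp add: insert_Diff_if)
    then have "y \<in> cl M {e, x}" using cl_mono[of "{x}" "{e, x}"] by auto
    moreover have "x \<in> cl M {e}" using xy(2) by (simp add: P_def)
    ultimately have "rank M {y, e, x} = rank M {e}" "y \<in> ground M"
      by (auto simp: cl_def insert_commute)
    moreover have "rank M {y, e} \<le> rank M {y, e, x}" "rank M {e} \<le> rank M {y, e}"
      by (auto intro: rank_mono)
    ultimately have "y \<in> P" by (simp add: P_def cl_def)
    then show False using xy by simp
  qed
  then have "rank M (P \<union> (edges G - P)) = rank M P + rank M (edges G - P)"
    using PE by (intro rank_additive) (auto simp: ground_eq)
  then have "rank M (edges G) = rank M P + rank M (edges G - P)"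
    using PE by (simp add: Un_absorb1)
  then have "edges G - P = {}" using connectivity_1[OF PE] eP by fastforce
  then have "edges G \<subseteq> cl M {e}" by (simp add: P_def)
  then have "rank M ({e} \<union> edges G) = rank M {e}" by (rule rank_Un_cl[OF finite_edges])
  then have rank1: "rank M (edges G) = 1" using rank_indep[OF e] e_edge by (simp add: insert_absorb)
  show ?thesis
  proof (rule lifted_graphicI[OF e_edge e_loop e])
    fix D assume D: "D \<in> indeps M" "D \<noteq> {}"
    have eM: "e \<in> ground M" using e_edge by (simp add: ground_eq)
    have "rank M (insert e D) \<le> rank M (edges G)"
      using indeps_subset_ground[OF D(1)] e_edge by (intro rank_mono) (auto simp: ground_eq)
    moreover have "rank M D \<ge> 1"
      using rank_indep[OF D(1)] D finite_indep by (simp add: Suc_le_eq card_gt_0_iff)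
    ultimately show "e \<in> cl M D" using rank1 rank_insert_notin_cl[OF eM, of D] by linarith
  qed
qed

lemma frame_or_lifted_graphic_large: "frame_matroid M \<or> lifted_graphic M"
proof (cases "\<forall>a. a \<in> verts G \<and> a \<noteq> v \<longrightarrow> card (incident (comp_avoiding_v a)) \<le> 1")
  case True
  then show ?thesis using lifted_graphic_if_scattered by blast
next
  case False
  then obtain a where a: "a \<in> verts G" "a \<noteq> v" and big: "\<not> card (incident (comp_avoiding_v a)) \<le> 1"
    by blast
  let ?A = "comp_avoiding_v a"
  let ?I = "incident ?A"
  have IE: "?I \<subseteq> edges G" by (auto simp: incident_def)
  have eI: "e \<in> edges G - ?I" using e_edge e_loop comp_avoiding_v(1)[OF a] by (simp add: incident_def)
  \<comment> \<open>With two elements on each side, \<open>comp_connectivity\<close> would give a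
    2-separation.\<close>
  have "card (edges G - ?I) \<le> 1"
    using connectivity_2[OF IE] comp_connectivity[OF a] big by linarith
  then have "edges G - ?I = {e}"
    using eI finite_edges card_le_Suc0_iff_eq[of "edges G - ?I"] by auto
  then have all: "edges G \<subseteq> insert e ?I" by auto
  show ?thesis
    using lifted_graphic_if_spanned[OF a no_matroid_loop[OF e_edge] all]
      frame_matroid_if_not_spanned[OF a all no_coloop[OF e_edge]] by blast
qed

end

lemma frame_or_lifted_graphic:
  assumes "n_connected 3 M" shows "frame_matroid M \<or> lifted_graphic M"
proof (cases "card (edges G) \<ge> 2")
  case True
  then show ?thesis using frame_or_lifted_graphic_large assms by simp
next
  case False
  then have E: "edges G = {e}"
    using e_edge finite_edges card_le_Suc0_iff_eq[of "edges G"] by auto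
  \<comment> \<open>The only possible circuit is \<open>{e}\<close>, which sits at one
    vertex.\<close>
  have "linked (ends G) C (vertices_of C)" if "circuit M C" for C
  proof -
    have "C = {e}" using circuit_edges[OF that] circuit_nonempty[OF that] E by auto
    then show ?thesis using e_loop by (auto simp: linked_def)
  qed
  then show ?thesis using frame_matroidI by blast
qed

end

theorem theorem1p5:
  fixes M :: "'e pre_matroid" and G :: "('v, 'e) pre_graph"
  assumes "matroid M"
    and "n_connected 3 M"
    and "graph G"
    and "framework G M"
    and "\<exists>v \<in> verts G. loops G v \<noteq> {}"
  shows "frame_matroid M \<or> lifted_graphic M"
proof -
  obtain v e where "e \<in> edges G" "ends G e = {v}" using assms(5) by (auto simp: loops_def)
  then interpret framework_with_loop M G e v
    by (intro framework_with_loop.intro framework_graph.intro framework_graph_axioms.intro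
        framework_with_loop_axioms.intro assms(1,3,4))
  show ?thesis by (rule frame_or_lifted_graphic[OF assms(2)])
qed

end
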